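(* If $f:\{0,1\}^N\to\{0,1\}$ is a non-constant symmetric Boolean function, then $Q_2(f)\in\Theta\big(\sqrt{N(N-\Gamma(f))}\big)$. That is, there are absolute constants $c_1,c_2>0$ such that for every $N\ge1$ and every non-constant symmetric $f:\{0,1\}^N\to\{0,1\}$, $$c_1\sqrt{N(N-\Gamma(f))}\le Q_2(f)\le c_2\sqrt{N(N-\Gamma(f))}.$$
   Context: $f$ is symmetric if $f(X)$ depends only on the Hamming weight $|X|$ (number of 1s in $X$). For symmetric $f$ let $f_k=f(X)$ for $|X|=k$, and for non-constant symmetric $f$ define $$\Gamma(f)=\min\{|2k-N+1| : f_k\neq f_{k+1}\text{ and }0\le k\le N-1\}.$$ Quantum networks: the input $X=(x_0,\ldots,x_{N-1})\in\{0,1\}^N$ is given as a black-box. A quantum network with $T$ queries acts on $m$ qubits (for some $m$) and is a sequence of unitary transformations $U_0,O,U_1,O,\ldots,U_{T-1},O,U_T$ applied in this order to the initial state $|0\rangle$, where the $U_j$ are arbitrary unitaries on $m$ qubits not depending on $X$, and the query $O$ (depending on $X$) maps each basis state $|i,b,z\rangle$ to $|i,b\oplus x_i,z\rangle$; here $i$ consists of $\lceil\log_2 N\rceil$ bits, $b$ is one bit, and $z$ consists of the remaining $m-\lceil\log_2 N\rceil-1$ bits (if $i\ge N$, the query leaves the basis state unchanged). The output is the value obtained by measuring the rightmost bit of the final state in the computational basis. The network computes $f$ with bounded error if for every $X\in\{0,1\}^N$ the output equals $f(X)$ with probability at least $2/3$. $Q_2(f)$ is the minimum $T$ such that some quantum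 network with $T$ queries computes $f$ with bounded error. *)

theory Defs
  imports Complex_Main "Jordan_Normal_Form.Schur_Decomposition"
begin

text \<open>
  Inputs \<open>X \<in> {0,1}^N\<close> are Boolean lists of length \<open>N\<close>, with \<open>X ! i\<close> the variable \<open>x_i\<close>.
  A Boolean function on \<open>{0,1}^N\<close> is given by a function on all Boolean lists; its values on
  lists of other lengths play no role.
\<close>

definition cube :: "nat \<Rightarrow> bool list set" where
  "cube N = {X. length X = N}"

definition hamming_weight :: "bool list \<Rightarrow> nat" where
  "hamming_weight X = count_list X True"

definition symmetric_on_cube :: "nat \<Rightarrow> (bool list \<Rightarrow> bool) \<Rightarrow> bool" where
  "symmetric_on_cube N f \<longleftrightarrow>
    (\<forall>X\<in>cube N. \<forall>Y\<in>cube N. hamming_weight X = hamming_weight Y \<longrightarrow> f X = f Y)"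

definition nonconstant_on_cube :: "nat \<Rightarrow> (bool list \<Rightarrow> bool) \<Rightarrow> bool" where
  "nonconstant_on_cube N f \<longleftrightarrow> (\<exists>X\<in>cube N. \<exists>Y\<in>cube N. f X \<noteq> f Y)"

text \<open>The value \<open>f_k\<close>; it is determined when \<open>f\<close> is symmetric and \<open>k \<le> N\<close>.\<close>

definition weight_value :: "nat \<Rightarrow> (bool list \<Rightarrow> bool) \<Rightarrow> nat \<Rightarrow> bool" where
  "weight_value N f k = (THE v. \<forall>X\<in>cube N. hamming_weight X = k \<longrightarrow> f X = v)"

text \<open>The set is nonempty when \<open>f\<close> is symmetric and non-constant.\<close>

definition Gamma_sym :: "nat \<Rightarrow> (bool list \<Rightarrow> bool) \<Rightarrow> int" where
  "Gamma_sym N f =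
    Min {\<bar>2 * int k - int N + 1\<bar> | k. k < N \<and> weight_value N f k \<noteq> weight_value N f (Suc k)}"

definition unitary_mat :: "nat \<Rightarrow> complex mat \<Rightarrow> bool" where
  "unitary_mat d U \<longleftrightarrow> U \<in> carrier_mat d d \<and>
     mat_adjoint U * U = 1\<^sub>m d \<and> U * mat_adjoint U = 1\<^sub>m d"

definition index_bits :: "nat \<Rightarrow> nat" where
  "index_bits N = nat \<lceil>log 2 (real N)\<rceil>"

text \<open>
  The \<open>m\<close>-bit basis states are numbered by \<open>{0..<2^m}\<close>, the leftmost bit being the most
  significant one. With \<open>l = m - index_bits N - 1\<close> workspace bits, \<open>|i,b,z\<rangle>\<close> is thus basis
  state number \<open>(2 * i + b) * 2^l + z\<close>, where \<open>b < 2\<close> and \<open>z < 2^l\<close>. The following function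
  gives the number of the basis state to which the query takes basis state number \<open>s\<close>.
\<close>

definition query_state :: "nat \<Rightarrow> nat \<Rightarrow> bool list \<Rightarrow> nat \<Rightarrow> nat" where
  "query_state N m X s =
    (let l = m - index_bits N - 1;
         i = s div 2 ^ (l + 1);
         b = (s div 2 ^ l) mod 2;
         z = s mod 2 ^ l
     in if i < N then (2 * i + (b + of_bool (X ! i)) mod 2) * 2 ^ l + z else s)"

definition query_mat :: "nat \<Rightarrow> nat \<Rightarrow> bool list \<Rightarrow> complex mat" where
  "query_mat N m X = mat (2 ^ m) (2 ^ m) (\<lambda>(r, s). if r = query_state N m X s then 1 else 0)"

text \<open>The state after \<open>U_0, O, U_1, \<dots>, O, U_t\<close>, for the initial state \<open>|0\<rangle>\<close>.\<close>

primrec network_state ::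
  "nat \<Rightarrow> nat \<Rightarrow> (nat \<Rightarrow> complex mat) \<Rightarrow> bool list \<Rightarrow> nat \<Rightarrow> complex vec" where
  "network_state N m U X 0 = U 0 *\<^sub>v unit_vec (2 ^ m) 0"
| "network_state N m U X (Suc t) =
     U (Suc t) *\<^sub>v (query_mat N m X *\<^sub>v network_state N m U X t)"

text \<open>Probability that measuring the rightmost (least significant) bit yields \<open>v\<close>.\<close>

definition output_prob ::
  "nat \<Rightarrow> nat \<Rightarrow> nat \<Rightarrow> (nat \<Rightarrow> complex mat) \<Rightarrow> bool list \<Rightarrow> bool \<Rightarrow> real" where
  "output_prob N m T U X v =
    (\<Sum>s | s < 2 ^ m \<and> odd s = v. (cmod (network_state N m U X T $ s))\<^sup>2)"

text \<open>The unitaries \<open>U j\<close> with \<open>j > T\<close> are not part of the network.\<close>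

definition quantum_network :: "nat \<Rightarrow> nat \<Rightarrow> nat \<Rightarrow> (nat \<Rightarrow> complex mat) \<Rightarrow> bool" where
  "quantum_network N m T U \<longleftrightarrow>
     index_bits N + 1 \<le> m \<and> (\<forall>j\<le>T. unitary_mat (2 ^ m) (U j))"

definition computes_bounded_error ::
  "nat \<Rightarrow> (bool list \<Rightarrow> bool) \<Rightarrow> nat \<Rightarrow> nat \<Rightarrow> (nat \<Rightarrow> complex mat) \<Rightarrow> bool" where
  "computes_bounded_error N f m T U \<longleftrightarrow> (\<forall>X\<in>cube N. output_prob N m T U X (f X) \<ge> 2 / 3)"

definition Q2 :: "nat \<Rightarrow> (bool list \<Rightarrow> bool) \<Rightarrow> nat" where
  "Q2 N f = (LEAST T. \<exists>m U. quantum_network N m T U \<and> computes_bounded_error N f m T U)"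

end

theory Submission
  imports Defs
begin

text \<open>
  Lower bound: if \<open>f_k \<noteq> f_(k+1)\<close>, Ambainis' adversary argument over the pairs of inputs of
  weights \<open>k\<close> and \<open>k + 1\<close> at Hamming distance one gives \<open>\<Omega>(sqrt ((N - k) * (k + 1)))\<close> queries.
  For the \<open>k\<close> attaining the minimum in \<open>\<Gamma>(f)\<close> this is the claimed order of magnitude.

  Upper bound: no search algorithm is used. Suppose vectors \<open>v_(x,i)\<close> satisfy
  \<open>2 * (\<Sum>i. x_i \<noteq> y_i. \<langle>v_(x,i), v_(y,i)\<rangle>) = [f x \<noteq> f y]\<close> (a dual solution of the adversary
  bound), and let \<open>v_x = (\<Sum>i. |i\<rangle>|-\<rangle>v_(x,i))\<close>. The query \<open>O_x\<close> flips the sign of the components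
  with \<open>x_i = 1\<close>, so by equality of Gram matrices there is a unitary independent of \<open>x\<close> that takes
  \<open>|0\<rangle> + O_x v_x\<close> to \<open>|f x\<rangle> + v_x\<close>: with the catalyst \<open>v_x\<close>, one query suffices. Starting from
  the superposition of \<open>K\<close> copies of \<open>|0\<rangle>\<close>, the same catalyst serves all copies in turn, and
  omitting it costs only an error of norm \<open>|v_x| / sqrt K\<close>. Hence \<open>K = O(max |v_x|^2)\<close> queries are
  enough. For symmetric \<open>f\<close>, explicit vectors built from the Hilbert-type matrix
  \<open>[f_k \<noteq> f_l] / (k - l)\<close> have the required size.
\<close>

subsection \<open>Sums of inverse squares\<close>

lemma sum_inverse_squares_le_2: "(\<Sum>n<m. 1 / (real (Suc n))\<^sup>2) \<le> 2"
proof -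
  \<comment> \<open>The subtracted \<open>1 / (m + 1)\<close> makes the induction telescope, because
    \<open>1 / (m + 2)^2 \<le> 1 / (m + 1) - 1 / (m + 2)\<close>.\<close>
  have "(\<Sum>n<Suc m. 1 / (real (Suc n))\<^sup>2) \<le> 2 - 1 / (real m + 1)" for m
  proof (induction m)
    case (Suc m)
    have "1 / (real m + 2)\<^sup>2 \<le> 1 / ((real m + 1) * (real m + 2))"
      unfolding power2_eq_square by (intro divide_left_mono mult_right_mono) auto
    also have "\<dots> = 1 / (real m + 1) - 1 / (real m + 2)"
      by (simp add: field_simps)
    finally show ?case using Suc by (simp add: add.commute)
  qed simp
  then have "(\<Sum>n<Suc m. 1 / (real (Suc n))\<^sup>2) \<le> 2 - 1 / (real m + 1)" for m .
  then have "(\<Sum>n<Suc m. 1 / (real (Suc n))\<^sup>2) \<le> 2" for m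
    by (rule order_trans) simp
  then show ?thesis by (cases m) auto
qed

lemma sum_inverse_square_distances_le_4:
  "(\<Sum>z\<le>N. 1 / (real k - real z)\<^sup>2) \<le> 4"
proof -
  have below: "(\<Sum>z<k. 1 / (real k - real z)\<^sup>2) \<le> 2"
  proof -
    have "(\<Sum>z<k. 1 / (real k - real z)\<^sup>2) = (\<Sum>z<k. 1 / (real k - real (k - Suc z))\<^sup>2)"
      by (rule sum.nat_diff_reindex [symmetric])
    also have "\<dots> = (\<Sum>z<k. 1 / (real (Suc z))\<^sup>2)"
      by (intro sum.cong) (auto simp: of_nat_diff)
    also have "\<dots> \<le> 2" by (rule sum_inverse_squares_le_2)
    finally show ?thesis .
  qed
  have above: "(\<Sum>z\<in>{k<..k + M}. 1 / (real k - real z)\<^sup>2) \<le> 2" for M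
  proof -
    have "(\<Sum>z\<in>{k<..k + M}. 1 / (real k - real z)\<^sup>2) = (\<Sum>n<M. 1 / (real (Suc n))\<^sup>2)"
      by (rule sum.reindex_bij_witness[of _ "\<lambda>n. k + Suc n" "\<lambda>z. z - Suc k"])
        (auto simp: power2_commute)
    also have "\<dots> \<le> 2" by (rule sum_inverse_squares_le_2)
    finally show ?thesis .
  qed
  \<comment> \<open>The term \<open>z = k\<close> is \<open>1 / 0 = 0\<close>, so only the two sides
    of \<open>k\<close> count; the upper side is extended to \<open>k + N\<close> in order to cover
    every \<open>z \<le> N\<close>.\<close>
  have "(\<Sum>z\<le>N. 1 / (real k - real z)\<^sup>2)
      \<le> (\<Sum>z\<in>{..<k} \<union> {k} \<union> {k<..k + N}. 1 / (real k - real z)\<^sup>2)"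
    by (rule sum_mono2) auto
  also have "\<dots> = (\<Sum>z<k. 1 / (real k - real z)\<^sup>2) + (\<Sum>z\<in>{k<..k + N}. 1 / (real k - real z)\<^sup>2)"
    by (subst sum.union_disjoint; (subst sum.union_disjoint)?) auto
  finally show ?thesis using below above[of N] by simp
qed

text \<open>Serves both halves of the dual solution. For \<open>k \<le> 2 * t\<close> the sum of
  inverse squares is at most 4. Otherwise only the \<open>t\<close> entries with
  \<open>z < t\<close> survive, each at distance at least \<open>k / 2\<close> from
  \<open>k\<close>, so the sum is at most \<open>4 * t / k^2\<close>. The bound on \<open>b\<close>
  forces \<open>b k = 0\<close>, because \<open>1 / 0 = 0\<close>.\<close>

lemma weighted_square_sum_le:
  fixes b :: "nat \<Rightarrow> real"
  assumes b: "\<And>z. (b z)\<^sup>2 \<le> 1 / (real k - real z)\<^sup>2"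
    and zero: "\<And>z. t \<le> k \<Longrightarrow> t \<le> z \<Longrightarrow> b z = 0"
    and t: "t \<ge> 1"
  shows "real k * (\<Sum>z\<le>N. (b z)\<^sup>2) \<le> 8 * real t"
proof (cases "k \<le> 2 * t")
  case True
  have "(\<Sum>z\<le>N. (b z)\<^sup>2) \<le> 4"
    using sum_mono[of "{..N}" "\<lambda>z. (b z)\<^sup>2", OF b] sum_inverse_square_distances_le_4[of k N]
    by linarith
  then have "real k * (\<Sum>z\<le>N. (b z)\<^sup>2) \<le> (2 * real t) * 4"
    using True by (intro mult_mono sum_nonneg) auto
  then show ?thesis by simp
next
  case False
  have "(\<Sum>z\<le>N. (b z)\<^sup>2) \<le> (\<Sum>z<t. 4 / (real k)\<^sup>2)"
  proof -
    have "(\<Sum>z\<le>N. (b z)\<^sup>2) = (\<Sum>z\<in>{..N} \<inter> {..<t}. (b z)\<^sup>2)"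
      using False zero by (intro sum.mono_neutral_right) (auto simp: not_less[symmetric])
    also have "\<dots> \<le> (\<Sum>z<t. (b z)\<^sup>2)" by (intro sum_mono2) auto
    also have "\<dots> \<le> (\<Sum>z<t. 4 / (real k)\<^sup>2)"
    proof (rule sum_mono)
      fix z assume "z \<in> {..<t}"
      then have "real k / 2 \<le> real k - real z" using False by auto
      then have "(real k / 2)\<^sup>2 \<le> (real k - real z)\<^sup>2" by (intro power_mono) auto
      moreover have "0 < (real k / 2)\<^sup>2" using False by simp
      ultimately have "1 / (real k - real z)\<^sup>2 \<le> 1 / (real k / 2)\<^sup>2"
        by (intro divide_left_mono mult_pos_pos) linarith+
      then show "(b z)\<^sup>2 \<le> 4 / (real k)\<^sup>2"
        using b[of z] by (simp add: power_divide)
    qed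
    finally show ?thesis .
  qed
  then have "real k * (\<Sum>z\<le>N. (b z)\<^sup>2) \<le> real k * (real t * (4 / (real k)\<^sup>2))"
    by (intro mult_left_mono) auto
  also have "\<dots> = 4 * real t / real k" using False by (simp add: power2_eq_square)
  also have "\<dots> \<le> 4 * real t / 1" using False t by (intro divide_left_mono) auto
  finally show ?thesis by simp
qed

subsection \<open>Unitaries from equal Gram matrices\<close>

text \<open>The reflection in the hyperplane orthogonal to \<open>h\<close>. For
  \<open>h = 0\<close> division by zero makes it the identity, which is still orthogonal.\<close>

definition householder :: "real vec \<Rightarrow> real mat" where
  "householder h = mat (dim_vec h) (dim_vec h)
     (\<lambda>(i, j). of_bool (i = j) - 2 / (h \<bullet> h) * h $ i * h $ j)"

lemma householder_carrier [simp]: "h \<in> carrier_vec d \<Longrightarrow> householder h \<in> carrier_mat d d"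
  by (auto simp: householder_def)

lemma householder_transpose: "transpose_mat (householder h) = householder h"
  by (rule eq_matI) (auto simp: householder_def)

lemma householder_mult_vec:
  assumes "h \<in> carrier_vec d" "x \<in> carrier_vec d"
  shows "householder h *\<^sub>v x = x - (2 * (h \<bullet> x) / (h \<bullet> h)) \<cdot>\<^sub>v h"
proof (rule eq_vecI)
  fix i assume "i < dim_vec (x - (2 * (h \<bullet> x) / (h \<bullet> h)) \<cdot>\<^sub>v h)"
  then have i: "i < d" using assms by simp
  define c where "c = 2 / (h \<bullet> h)"
  have "(householder h *\<^sub>v x) $ i
      = (\<Sum>j = 0..<d. (of_bool (i = j) - c * h $ i * h $ j) * x $ j)"
    using assms i by (simp add: householder_def scalar_prod_def c_def)
  also have "\<dots> = (\<Sum>j = 0..<d. (if i = j then x $ j else 0)) - c * h $ i * (\<Sum>j = 0..<d. h $ j * x $ j)"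
    unfolding sum_distrib_left sum_subtractf[symmetric]
    by (intro sum.cong) (auto simp: algebra_simps)
  also have "\<dots> = x $ i - c * h $ i * (h \<bullet> x)"
    using assms i by (simp add: scalar_prod_def)
  finally show "(householder h *\<^sub>v x) $ i = (x - (2 * (h \<bullet> x) / (h \<bullet> h)) \<cdot>\<^sub>v h) $ i"
    using assms i by (simp add: c_def)
qed (use assms in \<open>auto simp: householder_def\<close>)

lemma householder_square:
  assumes "h \<in> carrier_vec d"
  shows "householder h * householder h = 1\<^sub>m d"
proof (rule eq_matI)
  fix i j assume "i < dim_row (1\<^sub>m d)" "j < dim_col (1\<^sub>m d)"
  then have ij: "i < d" "j < d" by auto
  define c where "c = 2 / (h \<bullet> h)"
  have "(householder h * householder h) $$ (i, j)
      = (\<Sum>k = 0..<d. (of_bool (i = k) - c * h $ i * h $ k) * (of_bool (k = j) - c * h $ k * h $ j))"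
    using assms ij by (simp add: householder_def scalar_prod_def c_def)
  also have "\<dots> = (\<Sum>k = 0..<d. (if i = k then of_bool (k = j) - c * h $ k * h $ j else 0)
      - (if k = j then c * h $ i * h $ k else 0) + c * h $ i * c * h $ j * (h $ k * h $ k))"
    by (intro sum.cong) (auto simp: algebra_simps)
  also have "\<dots> = of_bool (i = j) - c * h $ i * h $ j - c * h $ i * h $ j + c * h $ i * c * h $ j * (h \<bullet> h)"
    using assms ij by (simp add: sum.distrib sum_subtractf sum_distrib_left[symmetric] scalar_prod_def)
  also have "\<dots> = of_bool (i = j)" by (cases "h \<bullet> h = 0") (auto simp: c_def)
  finally show "(householder h * householder h) $$ (i, j) = 1\<^sub>m d $$ (i, j)"
    using ij by simp
qed (use assms in \<open>auto simp: householder_def\<close>)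

lemma orthogonal_mat_scalar_prod:
  fixes U :: "real mat"
  assumes "U \<in> carrier_mat d d" "transpose_mat U * U = 1\<^sub>m d" "x \<in> carrier_vec d" "y \<in> carrier_vec d"
  shows "(U *\<^sub>v x) \<bullet> (U *\<^sub>v y) = x \<bullet> y"
proof -
  have "(U *\<^sub>v x) \<bullet> (U *\<^sub>v y) = (U *\<^sub>v y) \<bullet> (U *\<^sub>v x)"
    using assms by (intro comm_scalar_prod[of _ d]) auto
  also have "\<dots> = (transpose_mat U *\<^sub>v (U *\<^sub>v y)) \<bullet> x"
    using assms by (subst transpose_vec_mult_scalar[of U d d]) auto
  also have "transpose_mat U *\<^sub>v (U *\<^sub>v y) = y"
    using assms by (subst assoc_mult_mat_vec[symmetric, of _ d d _ d]) auto
  finally show ?thesis using assms comm_scalar_prod by metis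
qed

text \<open>
  Extending an isometry one vector at a time: the already treated images are orthogonal to
  the difference vector \<open>h\<close>, so the reflection along \<open>h\<close> does not move them.
\<close>

lemma orthogonal_mat_of_equal_gram:
  fixes u w :: "'a \<Rightarrow> real vec"
  assumes "finite S"
    and "\<And>x. x \<in> S \<Longrightarrow> u x \<in> carrier_vec d" "\<And>x. x \<in> S \<Longrightarrow> w x \<in> carrier_vec d"
    and "\<And>x y. x \<in> S \<Longrightarrow> y \<in> S \<Longrightarrow> u x \<bullet> u y = w x \<bullet> w y"
  shows "\<exists>U. U \<in> carrier_mat d d \<and> transpose_mat U * U = 1\<^sub>m d \<and> U * transpose_mat U = 1\<^sub>m d
    \<and> (\<forall>x\<in>S. U *\<^sub>v u x = w x)"
  using assms
proof (induction S)
  case empty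
  show ?case by (rule exI[of _ "1\<^sub>m d"]) auto
next
  case (insert a S)
  then obtain U where U: "U \<in> carrier_mat d d" "transpose_mat U * U = 1\<^sub>m d" "U * transpose_mat U = 1\<^sub>m d"
    "\<And>x. x \<in> S \<Longrightarrow> U *\<^sub>v u x = w x" by (smt (verit) insertCI)
  define v where "v = U *\<^sub>v u a"
  define h where "h = v - w a"
  define H where "H = householder h"
  have car: "v \<in> carrier_vec d" "w a \<in> carrier_vec d" "h \<in> carrier_vec d" "H \<in> carrier_mat d d"
    using U insert.prems by (auto simp: v_def h_def H_def)
  have HH: "H * H = 1\<^sub>m d" "transpose_mat H = H"
    using car by (auto simp: H_def householder_square householder_transpose)
  have vv: "v \<bullet> v = w a \<bullet> w a"
    using U insert.prems by (simp add: v_def orthogonal_mat_scalar_prod)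
  \<comment> \<open>As \<open>v\<close> and \<open>w a\<close> have equal norms, the coefficient
    \<open>2 * (h \<bullet> v) / (h \<bullet> h)\<close> of the reflection is 1, so that
    \<open>v\<close> goes to \<open>v - h = w a\<close>.\<close>
  have hh: "h \<bullet> h = 2 * (h \<bullet> v)"
  proof -
    have "h \<bullet> w a = v \<bullet> w a - v \<bullet> v" "h \<bullet> v = v \<bullet> v - v \<bullet> w a"
      using car vv comm_scalar_prod[of v d "w a"]
      by (auto simp: h_def minus_scalar_prod_distrib[of _ d])
    moreover have "h \<bullet> h = h \<bullet> v - h \<bullet> w a"
      using car unfolding h_def by (simp add: scalar_prod_minus_distrib[of _ d])
    ultimately show ?thesis by simp
  qed
  have a: "H *\<^sub>v v = w a"
  proof (cases "h \<bullet> h = 0")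
    case True
    then have "h = 0\<^sub>v d"
      using car conjugate_square_eq_0_vec[of h d] by (simp add: vec_conjugate_real)
    then have "v $ i = w a $ i" if "i < d" for i
      using car that unfolding h_def by (metis index_minus_vec(1) index_zero_vec(1) carrier_vecD right_minus_eq)
    then have "v = w a" using car by (intro eq_vecI) auto
    moreover have "w a - 0 \<cdot>\<^sub>v h = w a" using car by (intro eq_vecI) auto
    ultimately show ?thesis using True car by (simp add: H_def householder_mult_vec[of _ d])
  next
    case False
    then have "H *\<^sub>v v = v - h"
      using hh car by (simp add: H_def householder_mult_vec[of _ d])
    then show ?thesis using car by (auto simp: h_def)
  qed
  have S: "H *\<^sub>v w x = w x" if x: "x \<in> S" for x
  proof -
    have wx: "w x \<in> carrier_vec d" using insert.prems x by auto
    have "v \<bullet> w x = u a \<bullet> u x"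
      using U x insert.prems orthogonal_mat_scalar_prod[of U d "u a" "u x"] by (simp add: v_def)
    then have "h \<bullet> w x = 0"
      using car wx x insert.prems by (simp add: h_def minus_scalar_prod_distrib[of _ d])
    moreover have "w x - 0 \<cdot>\<^sub>v h = w x" using car wx by (intro eq_vecI) auto
    ultimately show ?thesis using car wx by (simp add: H_def householder_mult_vec[of _ d])
  qed
  have t: "transpose_mat (H * U) = transpose_mat U * H"
    using car U HH by (simp add: transpose_mult[of _ d d _ d])
  have "transpose_mat U * H * (H * U) = transpose_mat U * ((H * H) * U)"
    using car U by (simp add: assoc_mult_mat[of _ d d _ d _ d])
  moreover have "H * U * (transpose_mat U * H) = (H * (U * transpose_mat U)) * H"
    using car(4) U(1) by (simp add: assoc_mult_mat[of _ d d _ d _ d])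
  ultimately have orth: "transpose_mat (H * U) * (H * U) = 1\<^sub>m d" "H * U * transpose_mat (H * U) = 1\<^sub>m d"
    using HH U car t by auto
  have "(H * U) *\<^sub>v u x = w x" if "x \<in> insert a S" for x
    using that a S U(4) v_def U(1) car insert.prems(1)
    by (auto simp: assoc_mult_mat_vec[of _ d d _ d])
  then show ?case using orth U car by (intro exI[of _ "H * U"]) auto
qed

lemma mat_adjoint_index:
  assumes "A \<in> carrier_mat n m" "i < m" "j < n"
  shows "mat_adjoint A $$ (i, j) = conjugate (A $$ (j, i))"
  using assms by (simp add: mat_adjoint_def mat_of_rows_index)

lemma mat_adjoint_of_real:
  assumes "A \<in> carrier_mat n m"
  shows "mat_adjoint (map_mat complex_of_real A) = map_mat complex_of_real (transpose_mat A)"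
proof (rule eq_matI)
  fix i j assume ij: "i < dim_row (map_mat complex_of_real (transpose_mat A))"
    "j < dim_col (map_mat complex_of_real (transpose_mat A))"
  then show "mat_adjoint (map_mat complex_of_real A) $$ (i, j)
      = map_mat complex_of_real (transpose_mat A) $$ (i, j)"
    using assms by (subst mat_adjoint_index[of _ n m]) auto
qed (use assms in \<open>auto simp: mat_adjoint_def\<close>)

text \<open>Source of all unitaries of the network built for the upper bound: its intended states
  are real, so a real orthogonal matrix read as a complex one suffices.\<close>

lemma unitary_mat_of_equal_gram:
  fixes u w :: "'a \<Rightarrow> real vec"
  assumes "finite S"
    and "\<And>x. x \<in> S \<Longrightarrow> u x \<in> carrier_vec d" "\<And>x. x \<in> S \<Longrightarrow> w x \<in> carrier_vec d"
    and "\<And>x y. x \<in> S \<Longrightarrow> y \<in> S \<Longrightarrow> u x \<bullet> u y = w x \<bullet> w y"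
  shows "\<exists>U. unitary_mat d U \<and>
    (\<forall>x\<in>S. U *\<^sub>v map_vec complex_of_real (u x) = map_vec complex_of_real (w x))"
proof -
  obtain U where U: "U \<in> carrier_mat d d" "transpose_mat U * U = 1\<^sub>m d" "U * transpose_mat U = 1\<^sub>m d"
    "\<And>x. x \<in> S \<Longrightarrow> U *\<^sub>v u x = w x"
    using orthogonal_mat_of_equal_gram[of S u d w, OF assms] by blast
  show ?thesis
  proof (intro exI[of _ "map_mat complex_of_real U"] conjI ballI)
    have "map_mat complex_of_real (transpose_mat U * U) = 1\<^sub>m d"
      "map_mat complex_of_real (U * transpose_mat U) = 1\<^sub>m d"
      unfolding U by (auto simp: of_real_hom.mat_hom_one)
    then show "unitary_mat d (map_mat complex_of_real U)"
      using U(1) by (simp add: unitary_mat_def mat_adjoint_of_real[OF U(1)] of_real_hom.mat_hom_mult[of _ d d _ d])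
    fix x assume x: "x \<in> S"
    show "map_mat complex_of_real U *\<^sub>v map_vec complex_of_real (u x) = map_vec complex_of_real (w x)"
      by (simp only: of_real_hom.mult_mat_vec_hom[OF U(1) assms(2)[OF x], symmetric] U(4)[OF x])
  qed
qed

subsection \<open>Unitarity of networks\<close>

lemma mat_adjoint_carrier:
  "A \<in> carrier_mat n m \<Longrightarrow> mat_adjoint A \<in> carrier_mat m n"
  by (auto simp: mat_adjoint_def)

definition ip :: "nat \<Rightarrow> complex vec \<Rightarrow> complex vec \<Rightarrow> complex" where
  "ip d x y = (\<Sum>s<d. x $ s * cnj (y $ s))"

lemma ip_self: "ip d x x = complex_of_real (\<Sum>s<d. (cmod (x $ s))\<^sup>2)"
  by (simp add: ip_def complex_norm_square[symmetric] del: of_real_power)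

lemma ip_unitary:
  assumes U: "unitary_mat d U" and x: "x \<in> carrier_vec d" and y: "y \<in> carrier_vec d"
  shows "ip d (U *\<^sub>v x) (U *\<^sub>v y) = ip d x y"
proof -
  have Uc: "U \<in> carrier_mat d d" and UU: "mat_adjoint U * U = 1\<^sub>m d"
    using U by (auto simp: unitary_mat_def)
  have adj: "(\<Sum>s<d. U $$ (s, j) * cnj (U $$ (s, k))) = of_bool (k = j)" if "j < d" "k < d" for j k
  proof -
    have "(mat_adjoint U * U) $$ (k, j) = (\<Sum>s = 0..<d. mat_adjoint U $$ (k, s) * U $$ (s, j))"
      using that Uc mat_adjoint_carrier[OF Uc] by (simp add: scalar_prod_def)
    also have "\<dots> = (\<Sum>s<d. U $$ (s, j) * cnj (U $$ (s, k)))"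
      using that Uc by (auto simp: mat_adjoint_index[of _ d d] lessThan_atLeast0 mult.commute intro!: sum.cong)
    finally show ?thesis unfolding UU using that by (cases "k = j") auto
  qed
  have entry: "(U *\<^sub>v z) $ s = (\<Sum>j<d. U $$ (s, j) * z $ j)" if "z \<in> carrier_vec d" "s < d" for z s
    using that Uc by (auto simp: scalar_prod_def lessThan_atLeast0 intro!: sum.cong)
  have "ip d (U *\<^sub>v x) (U *\<^sub>v y)
      = (\<Sum>s<d. \<Sum>j<d. \<Sum>k<d. (U $$ (s, j) * cnj (U $$ (s, k))) * (x $ j * cnj (y $ k)))"
    unfolding ip_def
    by (intro sum.cong) (auto simp: entry x y sum_product intro!: sum.cong)
  also have "\<dots> = (\<Sum>j<d. \<Sum>k<d. (\<Sum>s<d. U $$ (s, j) * cnj (U $$ (s, k))) * (x $ j * cnj (y $ k)))"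
    unfolding sum_distrib_right by (subst sum.swap) (intro sum.cong refl sum.swap)
  also have "\<dots> = (\<Sum>j<d. \<Sum>k<d. if k = j then x $ j * cnj (y $ k) else 0)"
    by (intro sum.cong refl) (auto simp: adj)
  also have "\<dots> = ip d x y" by (simp add: ip_def)
  finally show ?thesis .
qed

section \<open>The query as a permutation of the basis states\<close>

definition query_index :: "nat \<Rightarrow> nat \<Rightarrow> nat \<Rightarrow> nat" where
  "query_index N m s = s div 2 ^ (m - index_bits N)"

lemma le_two_power_index_bits: "N \<ge> 1 \<Longrightarrow> N \<le> 2 ^ index_bits N"
proof -
  assume N: "N \<ge> 1"
  then have "log 2 (real N) \<le> real (index_bits N)"
    unfolding index_bits_def by linarith
  then have "real N \<le> 2 powr real (index_bits N)"
    using N by (simp add: log_le_iff)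
  then have "real N \<le> real (2 ^ index_bits N)" by (simp add: powr_realpow)
  then show ?thesis by (simp only: of_nat_le_iff)
qed

lemma query_state_eq:
  assumes "index_bits N + 1 \<le> m"
  defines "l \<equiv> m - index_bits N - 1"
  shows "query_state N m X s = (if query_index N m s < N
     then (2 * query_index N m s + ((s div 2 ^ l) mod 2 + of_bool (X ! query_index N m s)) mod 2) * 2 ^ l + s mod 2 ^ l
     else s)"
proof -
  have "m - index_bits N = l + 1" using assms by simp
  then show ?thesis by (simp add: query_state_def query_index_def l_def Let_def)
qed

lemma div_mod_encoding:
  fixes i b z l :: nat
  assumes "b < 2" "z < 2 ^ l"
  shows "((2 * i + b) * 2 ^ l + z) div 2 ^ (l + 1) = i"
    "((2 * i + b) * 2 ^ l + z) div 2 ^ l mod 2 = b"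
    "((2 * i + b) * 2 ^ l + z) mod 2 ^ l = z"
proof -
  have *: "((2 * i + b) * 2 ^ l + z) div 2 ^ l = 2 * i + b" using assms by simp
  have "(2 ^ (l + 1) :: nat) = 2 ^ l * 2" by simp
  then show "((2 * i + b) * 2 ^ l + z) div 2 ^ (l + 1) = i"
    using * assms(1) div_mult2_eq[of "(2 * i + b) * 2 ^ l + z" "2 ^ l" 2]
    by (simp add: mult.commute)
  show "((2 * i + b) * 2 ^ l + z) div 2 ^ l mod 2 = b" using * assms by simp
  show "((2 * i + b) * 2 ^ l + z) mod 2 ^ l = z" using assms by simp
qed

lemma encoding_div_mod: "(2 * (s div 2 ^ (l + 1)) + s div 2 ^ l mod 2) * 2 ^ l + s mod 2 ^ l = (s :: nat)"
proof -
  have "s div 2 ^ (l + 1) = s div 2 ^ l div 2"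
    using div_mult2_eq[of s "2 ^ l" 2] by (simp add: mult.commute)
  then have "2 * (s div 2 ^ (l + 1)) + s div 2 ^ l mod 2 = s div 2 ^ l" by simp
  then show ?thesis by (simp only: div_mult_mod_eq)
qed

lemma query_index_query_state:
  assumes "index_bits N + 1 \<le> m"
  shows "query_index N m (query_state N m X s) = query_index N m s"
proof -
  have "m - index_bits N = (m - index_bits N - 1) + 1" using assms by simp
  then show ?thesis unfolding query_state_eq[OF assms]
    using div_mod_encoding(1) by (auto simp: query_index_def)
qed

text \<open>Adding the same bit twice modulo 2 cancels. Hence the query matrix is a permutation
  matrix that is its own inverse, and sums over basis states can be reindexed along it.\<close>

lemma query_state_query_state:
  assumes "index_bits N + 1 \<le> m"
  shows "query_state N m X (query_state N m X s) = s"
proof (cases "query_index N m s < N")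
  case False
  then show ?thesis by (simp add: query_state_eq[OF assms])
next
  case True
  define l where "l = m - index_bits N - 1"
  define i where "i = query_index N m s"
  define b where "b = s div 2 ^ l mod 2"
  define b' where "b' = (b + of_bool (X ! i)) mod 2"
  define z where "z = s mod 2 ^ l"
  have m: "m - index_bits N = l + 1" using assms by (simp add: l_def)
  have bz: "b' < 2" "z < 2 ^ l" by (auto simp: b'_def z_def)
  have q: "query_state N m X s = (2 * i + b') * 2 ^ l + z"
    using True by (simp add: query_state_eq[OF assms] l_def i_def b_def b'_def z_def)
  have "query_state N m X (query_state N m X s) = (2 * i + (b' + of_bool (X ! i)) mod 2) * 2 ^ l + z"
    using True query_index_query_state[OF assms, of X s] div_mod_encoding[OF bz, of i]
    by (simp add: query_state_eq[OF assms, of X "query_state N m X s", folded l_def] i_def[symmetric]) (simp add: q)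
  also have "(b' + of_bool (X ! i)) mod 2 = b" by (auto simp: b'_def b_def mod_simps)
  also have "(2 * i + b) * 2 ^ l + z = s"
    using encoding_div_mod[of s l] by (simp add: i_def b_def z_def query_index_def m)
  finally show ?thesis .
qed

lemma less_two_power_iff_query_index:
  assumes "index_bits N + 1 \<le> m"
  shows "s < 2 ^ m \<longleftrightarrow> query_index N m s < 2 ^ index_bits N"
proof -
  have "(2::nat) ^ m = 2 ^ index_bits N * 2 ^ (m - index_bits N)"
    using assms by (simp flip: power_add)
  then show ?thesis by (simp add: query_index_def div_less_iff_less_mult)
qed

lemma query_state_less:
  assumes "index_bits N + 1 \<le> m"
  shows "query_state N m X s < 2 ^ m \<longleftrightarrow> s < 2 ^ m"
  by (simp add: less_two_power_iff_query_index[OF assms] query_index_query_state[OF assms])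

text \<open>A query keeps the address register, so it permutes every set of basis states that is cut
  out by a condition \<open>P\<close> on the address.\<close>

lemma sum_query_state:
  assumes m: "index_bits N + 1 \<le> m"
  shows "(\<Sum>s | s < 2 ^ m \<and> P (query_index N m s). g (query_state N m X s))
    = (\<Sum>s | s < 2 ^ m \<and> P (query_index N m s). g s)"
  by (rule sum.reindex_bij_witness[of _ "query_state N m X" "query_state N m X"])
    (auto simp: query_state_query_state[OF m] query_state_less[OF m] query_index_query_state[OF m])

lemma query_mat_carrier [simp]: "query_mat N m X \<in> carrier_mat (2 ^ m) (2 ^ m)"
  by (simp add: query_mat_def)

lemma query_mat_mult_vec:
  assumes m: "index_bits N + 1 \<le> m" and x: "x \<in> carrier_vec (2 ^ m)" and s: "s < 2 ^ m"
  shows "(query_mat N m X *\<^sub>v x) $ s = x $ query_state N m X s"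
proof -
  have "(query_mat N m X *\<^sub>v x) $ s = (\<Sum>r = 0..<2 ^ m. (if s = query_state N m X r then 1 else 0) * x $ r)"
    using x s by (auto simp: query_mat_def scalar_prod_def intro!: sum.cong)
  also have "\<dots> = (\<Sum>r = 0..<2 ^ m. if r = query_state N m X s then x $ r else 0)"
    using query_state_query_state[OF m] by (intro sum.cong refl) auto
  also have "\<dots> = x $ query_state N m X s" using s by (simp add: query_state_less[OF m])
  finally show ?thesis .
qed

lemma ip_query:
  assumes m: "index_bits N + 1 \<le> m" and x: "x \<in> carrier_vec (2 ^ m)" and y: "y \<in> carrier_vec (2 ^ m)"
  shows "ip (2 ^ m) (query_mat N m X *\<^sub>v x) (query_mat N m X *\<^sub>v y) = ip (2 ^ m) x y"
  using sum_query_state[OF m, where P = "\<lambda>_. True" and g = "\<lambda>s. x $ s * cnj (y $ s)"]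
  by (simp add: ip_def query_mat_mult_vec[OF m] x y lessThan_def)

lemma network_state_carrier:
  assumes "quantum_network N m T U" "t \<le> T"
  shows "network_state N m U X t \<in> carrier_vec (2 ^ m)"
  using assms(2)
proof (induction t)
  case (Suc t)
  then show ?case
    using assms(1) mult_mat_vec_carrier[OF query_mat_carrier, of "network_state N m U X t" m N X]
    by (auto simp: quantum_network_def unitary_mat_def)
qed (use assms in \<open>auto simp: quantum_network_def unitary_mat_def\<close>)

lemma ip_network_state:
  assumes Q: "quantum_network N m T U" and "t \<le> T"
  shows "ip (2 ^ m) (network_state N m U X t) (network_state N m U X t) = 1"
  using assms(2)
proof (induction t)
  case 0
  have "ip (2 ^ m) (unit_vec (2 ^ m) 0) (unit_vec (2 ^ m) 0) = (\<Sum>s < (2::nat) ^ m. if s = 0 then 1 else 0)"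
    unfolding ip_def by (intro sum.cong) auto
  then show ?case using Q by (simp add: quantum_network_def ip_unitary)
next
  case (Suc t)
  then show ?case
    using Q network_state_carrier[OF Q, of t X]
    by (simp add: quantum_network_def ip_unitary ip_query mult_mat_vec_carrier[OF query_mat_carrier])
qed

subsection \<open>The adversary lower bound\<close>

text \<open>The query magnitude at \<open>i\<close>: for a unit vector, the probability of finding
  the address \<open>i\<close>.\<close>

definition query_mass :: "nat \<Rightarrow> nat \<Rightarrow> complex vec \<Rightarrow> nat \<Rightarrow> real" where
  "query_mass N m x i = (\<Sum>s | s < 2 ^ m \<and> query_index N m s = i. (cmod (x $ s))\<^sup>2)"

lemma sum_query_mass_le:
  assumes "finite I"
  shows "(\<Sum>i\<in>I. query_mass N m x i) \<le> (\<Sum>s<2 ^ m. (cmod (x $ s))\<^sup>2)"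
proof -
  have "(\<Sum>i\<in>I. query_mass N m x i)
      = (\<Sum>s\<in>(\<Union>i\<in>I. {s. s < 2 ^ m \<and> query_index N m s = i}). (cmod (x $ s))\<^sup>2)"
    unfolding query_mass_def using assms by (subst sum.UNION_disjoint) auto
  also have "\<dots> \<le> (\<Sum>s<2 ^ m. (cmod (x $ s))\<^sup>2)"
    by (intro sum_mono2) auto
  finally show ?thesis .
qed

text \<open>AM-GM with a free weight. It replaces Cauchy-Schwarz since its right-hand side is linear
  in the squares, so one weight can be chosen for a whole sum.\<close>

lemma mult_le_weighted_squares:
  fixes u v a :: real
  assumes "a > 0"
  shows "u * v \<le> (a * u\<^sup>2 + v\<^sup>2 / a) / 2"
proof -
  have "0 \<le> (a * u - v)\<^sup>2 / (2 * a)" using assms by simp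
  also have "\<dots> = (a * u\<^sup>2 + v\<^sup>2 / a) / 2 - u * v"
    using assms by (simp add: field_simps power2_eq_square)
  finally show ?thesis by simp
qed

text \<open>The query for \<open>X\<close> preserves inner products, so the change is the inner
  product of \<open>O_X x\<close> with \<open>(O_Y - O_X) y\<close>. The two queries agree on every
  address other than \<open>i\<close>, also on addresses from \<open>N\<close> on, where both are
  trivial. On address \<open>i\<close> weighted AM-GM applies, and queries do not alter the mass
  there.\<close>

lemma ip_query_change:
  assumes m: "index_bits N + 1 \<le> m" and x: "x \<in> carrier_vec (2 ^ m)" and y: "y \<in> carrier_vec (2 ^ m)"
    and XY: "\<And>j. j < N \<Longrightarrow> j \<noteq> i \<Longrightarrow> X ! j = Y ! j" and a: "a > 0"
  shows "cmod (ip (2 ^ m) (query_mat N m X *\<^sub>v x) (query_mat N m Y *\<^sub>v y) - ip (2 ^ m) x y)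
    \<le> a * query_mass N m x i + query_mass N m y i / a"
proof -
  let ?B = "{s. s < 2 ^ m \<and> query_index N m s = i}"
  let ?x = "\<lambda>s. x $ query_state N m X s"
  let ?yX = "\<lambda>s. y $ query_state N m X s" and ?yY = "\<lambda>s. y $ query_state N m Y s"
  have "ip (2 ^ m) (query_mat N m X *\<^sub>v x) (query_mat N m Y *\<^sub>v y) - ip (2 ^ m) x y
      = ip (2 ^ m) (query_mat N m X *\<^sub>v x) (query_mat N m Y *\<^sub>v y)
        - ip (2 ^ m) (query_mat N m X *\<^sub>v x) (query_mat N m X *\<^sub>v y)"
    by (simp only: ip_query[OF m x y])
  also have "\<dots> = (\<Sum>s<2 ^ m. ?x s * cnj (?yY s - ?yX s))"
    by (simp add: ip_def query_mat_mult_vec[OF m] x y sum_subtractf[symmetric] right_diff_distrib)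
  also have "\<dots> = (\<Sum>s\<in>?B. ?x s * cnj (?yY s - ?yX s))"
    using XY by (intro sum.mono_neutral_right) (auto simp: query_state_eq[OF m])
  finally have "cmod (ip (2 ^ m) (query_mat N m X *\<^sub>v x) (query_mat N m Y *\<^sub>v y) - ip (2 ^ m) x y)
      \<le> (\<Sum>s\<in>?B. cmod (?x s * cnj (?yY s - ?yX s)))"
    by (simp only: norm_sum)
  also have "\<dots> \<le> (\<Sum>s\<in>?B. a * (cmod (?x s))\<^sup>2 + ((cmod (?yY s))\<^sup>2 + (cmod (?yX s))\<^sup>2) / (2 * a))"
  proof (rule sum_mono)
    fix s
    have "cmod (?x s * cnj (?yY s - ?yX s)) = cmod (?x s) * cmod (?yY s - ?yX s)"
      by (simp only: norm_mult complex_mod_cnj)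
    also have "\<dots> \<le> cmod (?x s) * (cmod (?yY s) + cmod (?yX s))"
      by (intro mult_left_mono norm_triangle_ineq4) auto
    also have "\<dots> \<le> (a * (cmod (?x s))\<^sup>2 + (cmod (?yY s))\<^sup>2 / a) / 2 + (a * (cmod (?x s))\<^sup>2 + (cmod (?yX s))\<^sup>2 / a) / 2"
      unfolding distrib_left by (intro add_mono mult_le_weighted_squares a)
    also have "\<dots> = a * (cmod (?x s))\<^sup>2 + ((cmod (?yY s))\<^sup>2 + (cmod (?yX s))\<^sup>2) / (2 * a)"
      using a by (simp add: field_simps)
    finally show "cmod (?x s * cnj (?yY s - ?yX s))
      \<le> a * (cmod (?x s))\<^sup>2 + ((cmod (?yY s))\<^sup>2 + (cmod (?yX s))\<^sup>2) / (2 * a)" .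
  qed
  also have "\<dots> = a * (\<Sum>s\<in>?B. (cmod (?x s))\<^sup>2)
      + ((\<Sum>s\<in>?B. (cmod (?yY s))\<^sup>2) + (\<Sum>s\<in>?B. (cmod (?yX s))\<^sup>2)) / (2 * a)"
    by (simp add: sum.distrib sum_distrib_left sum_divide_distrib[symmetric])
  finally have *: "cmod (ip (2 ^ m) (query_mat N m X *\<^sub>v x) (query_mat N m Y *\<^sub>v y) - ip (2 ^ m) x y)
      \<le> a * (\<Sum>s\<in>?B. (cmod (?x s))\<^sup>2)
        + ((\<Sum>s\<in>?B. (cmod (?yY s))\<^sup>2) + (\<Sum>s\<in>?B. (cmod (?yX s))\<^sup>2)) / (2 * a)" .
  have "(\<Sum>s\<in>?B. (cmod (z $ query_state N m Z s))\<^sup>2) = query_mass N m z i" for z Z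
    using sum_query_state[OF m, where P = "\<lambda>j. j = i" and g = "\<lambda>s. (cmod (z $ s))\<^sup>2"]
    by (simp add: query_mass_def)
  then show ?thesis using * by simp
qed

lemma network_state_norm:
  assumes "quantum_network N m T U" "t \<le> T"
  shows "(\<Sum>s<2 ^ m. (cmod (network_state N m U X t $ s))\<^sup>2) = 1"
  using ip_network_state[OF assms, of X] unfolding ip_self by (simp only: of_real_eq_1_iff)

lemma output_prob_add:
  assumes "quantum_network N m T U"
  shows "output_prob N m T U X v + output_prob N m T U X (\<not> v) = 1"
proof -
  have "output_prob N m T U X v + output_prob N m T U X (\<not> v)
      = (\<Sum>s\<in>{s. s < 2 ^ m \<and> odd s = v} \<union> {s. s < 2 ^ m \<and> odd s = (\<not> v)}. (cmod (network_state N m U X T $ s))\<^sup>2)"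
    unfolding output_prob_def by (subst sum.union_disjoint) auto
  also have "{s. s < 2 ^ m \<and> odd s = v} \<union> {s. s < 2 ^ m \<and> odd s = (\<not> v)} = {..<(2::nat) ^ m}"
    by auto
  finally show ?thesis using network_state_norm[OF assms order_refl] by simp
qed

text \<open>Let \<open>p \<ge> 2/3\<close> and \<open>q \<le> 1/3\<close> be the probabilities of
  output \<open>v\<close> on \<open>X\<close> and \<open>Y\<close>. The optimal AM-GM weights on the
  two output halves are \<open>1 / sqrt 2\<close> and \<open>sqrt 2\<close>; the rational
  approximations \<open>3/4\<close> and \<open>4/3\<close> give
  \<open>25/24 - 7/24 * (p - q) \<le> 17/18\<close>.\<close>

lemma ip_output_le:
  assumes Q: "quantum_network N m T U"
    and pX: "output_prob N m T U X v \<ge> 2 / 3" and pY: "output_prob N m T U Y (\<not> v) \<ge> 2 / 3"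
  shows "cmod (ip (2 ^ m) (network_state N m U X T) (network_state N m U Y T)) \<le> 17 / 18"
proof -
  let ?x = "\<lambda>s. cmod (network_state N m U X T $ s)" and ?y = "\<lambda>s. cmod (network_state N m U Y T $ s)"
  let ?A = "{s. s < 2 ^ m \<and> odd s = v}" and ?B = "{s. s < 2 ^ m \<and> odd s = (\<not> v)}"
  let ?p = "output_prob N m T U"
  have half: "(\<Sum>s\<in>S. ?x s * ?y s) \<le> (c * (\<Sum>s\<in>S. (?x s)\<^sup>2) + (\<Sum>s\<in>S. (?y s)\<^sup>2) / c) / 2"
    if "c > 0" for c S
    using sum_mono[of S "\<lambda>s. ?x s * ?y s", OF mult_le_weighted_squares[OF that]]
    by (simp add: sum.distrib sum_distrib_left[symmetric] sum_divide_distrib[symmetric])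
  have "cmod (ip (2 ^ m) (network_state N m U X T) (network_state N m U Y T))
      \<le> (\<Sum>s<2 ^ m. cmod (network_state N m U X T $ s * cnj (network_state N m U Y T $ s)))"
    unfolding ip_def by (rule norm_sum)
  also have "\<dots> = (\<Sum>s\<in>?A \<union> ?B. ?x s * ?y s)"
    by (intro sum.cong) (auto simp: norm_mult)
  also have "\<dots> = (\<Sum>s\<in>?A. ?x s * ?y s) + (\<Sum>s\<in>?B. ?x s * ?y s)"
    by (subst sum.union_disjoint) auto
  also have "\<dots> \<le> (3 / 4 * ?p X v + ?p Y v / (3 / 4)) / 2 + (4 / 3 * ?p X (\<not> v) + ?p Y (\<not> v) / (4 / 3)) / 2"
    unfolding output_prob_def by (intro add_mono half) auto
  also have "\<dots> = 3 / 8 * ?p X v + 2 / 3 * ?p Y v + 2 / 3 * ?p X (\<not> v) + 3 / 8 * ?p Y (\<not> v)"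
    by (simp add: field_simps)
  also have "\<dots> \<le> 17 / 18"
    using output_prob_add[OF Q, of X v] output_prob_add[OF Q, of Y v] pX pY by linarith
  finally show ?thesis .
qed

section \<open>Levels of the cube and single-bit flips\<close>

lemma hamming_weight_eq_card: "hamming_weight X = card {i. i < length X \<and> X ! i}"
  by (simp add: hamming_weight_def count_list_eq_length_filter length_filter_conv_card eq_commute)

lemma finite_cube: "finite (cube N)"
  using finite_lists_length_eq[of "UNIV :: bool set" N] by (simp add: cube_def)

definition slice :: "nat \<Rightarrow> nat \<Rightarrow> bool list set" where
  "slice N k = {X \<in> cube N. hamming_weight X = k}"

lemma finite_slice: "finite (slice N k)"
  using finite_cube by (simp add: slice_def)

lemma slice_length: "X \<in> slice N k \<Longrightarrow> length X = N"
  by (simp add: slice_def cube_def)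

lemma slice_nonempty: "k \<le> N \<Longrightarrow> slice N k \<noteq> {}"
proof -
  assume "k \<le> N"
  then have "replicate k True @ replicate (N - k) False \<in> slice N k"
    by (simp add: slice_def cube_def hamming_weight_def count_list_eq_length_filter)
  then show ?thesis by blast
qed

lemma card_ones: "X \<in> slice N k \<Longrightarrow> card {i. i < N \<and> X ! i} = k"
  by (auto simp: slice_def cube_def hamming_weight_eq_card)

lemma card_zeros:
  assumes "X \<in> slice N k"
  shows "card {i. i < N \<and> \<not> X ! i} = N - k"
proof -
  have "{i. i < N \<and> \<not> X ! i} = {..<N} - {i. i < N \<and> X ! i}" by auto
  moreover have "card ({..<N} - {i. i < N \<and> X ! i}) = card {..<N} - card {i. i < N \<and> X ! i}"
    by (rule card_Diff_subset) auto
  ultimately show ?thesis using card_ones[OF assms] by simp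
qed

lemma flip_up:
  assumes "X \<in> slice N k" "i < N" "\<not> X ! i"
  shows "X[i := True] \<in> slice N (Suc k)"
proof -
  have "{j. j < N \<and> X[i := True] ! j} = insert i {j. j < N \<and> X ! j}"
    using assms slice_length[OF assms(1)] by (auto simp: nth_list_update)
  then have "hamming_weight (X[i := True]) = Suc k"
    using assms card_ones[OF assms(1)] slice_length[OF assms(1)] by (simp add: hamming_weight_eq_card)
  then show ?thesis using assms by (simp add: slice_def cube_def)
qed

lemma flip_down:
  assumes "X \<in> slice N (Suc k)" "i < N" "X ! i"
  shows "X[i := False] \<in> slice N k"
proof -
  have "{j. j < N \<and> X[i := False] ! j} = {j. j < N \<and> X ! j} - {i}"
    using assms slice_length[OF assms(1)] by (auto simp: nth_list_update)
  then have "hamming_weight (X[i := False]) = k"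
    using assms card_ones[OF assms(1)] slice_length[OF assms(1)] by (simp add: hamming_weight_eq_card)
  then show ?thesis using assms by (simp add: slice_def cube_def)
qed

text \<open>Double counting of the edges between two consecutive levels: an edge is determined by
  its flipped position together with either its lower or its upper end.\<close>

lemma sum_flips:
  "(\<Sum>X\<in>slice N k. \<Sum>i | i < N \<and> \<not> X ! i. g (X[i := True]) i)
    = (\<Sum>Y\<in>slice N (Suc k). \<Sum>i | i < N \<and> Y ! i. g Y i)"
proof -
  have "(\<Sum>(X, i)\<in>(SIGMA X:slice N k. {i. i < N \<and> \<not> X ! i}). g (X[i := True]) i)
    = (\<Sum>(Y, i)\<in>(SIGMA Y:slice N (Suc k). {i. i < N \<and> Y ! i}). g Y i)"
    by (rule sum.reindex_bij_witness[of _ "\<lambda>(Y, i). (Y[i := False], i)" "\<lambda>(X, i). (X[i := True], i)"])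
      (auto simp: flip_up flip_down slice_length list_update_same_conv)
  then show ?thesis by (simp add: sum.Sigma finite_slice)
qed

text \<open>
  Ambainis' adversary argument, over the pairs of inputs of weights \<open>k\<close> and \<open>Suc k\<close> that differ
  in one position. The weight \<open>a\<close> balances the contributions of the two levels.
\<close>

lemma adversary_bound:
  assumes Q: "quantum_network N m T U" and C: "computes_bounded_error N f m T U"
    and k: "k < N" and f: "\<And>X Y. X \<in> slice N k \<Longrightarrow> Y \<in> slice N (Suc k) \<Longrightarrow> f X \<noteq> f Y"
  shows "sqrt (real (N - k) * real (k + 1)) \<le> 36 * real T"
proof -
  let ?S = "slice N k" and ?S' = "slice N (Suc k)"
  let ?Z = "\<lambda>X. {i. i < N \<and> \<not> X ! i}"
  define \<psi> where "\<psi> X t = network_state N m U X t" for X t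
  \<comment> \<open>Progress measure over the \<open>E\<close> edges between the two levels. It
    starts at \<open>E\<close>, since all initial states coincide, must end with modulus at most
    \<open>17/18 * E\<close>, and moves by at most \<open>2 * E / r\<close> per query. So
    \<open>E / 18 \<le> T * (2 * E / r)\<close>, which is the constant 36.\<close>
  define W where "W t = (\<Sum>X\<in>?S. \<Sum>i\<in>?Z X. ip (2 ^ m) (\<psi> X t) (\<psi> (X[i := True]) t))" for t
  define E where "E = real (card ?S) * real (N - k)"
  define a where "a = sqrt (real (N - k) / real (k + 1))"
  define r where "r = sqrt (real (N - k) * real (k + 1))"
  have m: "index_bits N + 1 \<le> m" using Q by (simp add: quantum_network_def)
  have a: "a > 0" using k by (simp add: a_def)
  have r: "r > 0" using k by (simp add: r_def)
  have E: "E = (\<Sum>X\<in>?S. \<Sum>i\<in>?Z X. 1)"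
    by (simp add: E_def card_zeros)
  have E': "E = real (card ?S') * real (k + 1)"
    unfolding E sum_flips[where g = "\<lambda>_ _. 1 :: real"] by (simp add: card_ones)
  have E0: "E > 0"
    using k slice_nonempty[of k N] finite_slice by (simp add: E_def card_gt_0_iff)
  have step: "cmod (W (Suc t) - W t) \<le> 2 * E / r" if t: "t < T" for t
  proof -
    have car: "\<psi> X t \<in> carrier_vec (2 ^ m)" for X
      unfolding \<psi>_def using network_state_carrier[OF Q] t by simp
    have mass: "(\<Sum>i\<in>I. query_mass N m (\<psi> X t) i) \<le> 1" if "finite I" for X I
      using sum_query_mass_le[OF that, of N m "\<psi> X t"] network_state_norm[OF Q, of t X] t
      by (simp add: \<psi>_def)
    have "cmod (W (Suc t) - W t) \<le> (\<Sum>X\<in>?S. \<Sum>i\<in>?Z X.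
        cmod (ip (2 ^ m) (\<psi> X (Suc t)) (\<psi> (X[i := True]) (Suc t)) - ip (2 ^ m) (\<psi> X t) (\<psi> (X[i := True]) t)))"
      unfolding W_def sum_subtractf[symmetric]
      by (rule order_trans[OF norm_sum], rule sum_mono, rule norm_sum)
    also have "\<dots> \<le> (\<Sum>X\<in>?S. \<Sum>i\<in>?Z X. a * query_mass N m (\<psi> X t) i + query_mass N m (\<psi> (X[i := True]) t) i / a)"
    proof (intro sum_mono)
      fix X i assume X: "X \<in> ?S" and i: "i \<in> ?Z X"
      have U: "unitary_mat (2 ^ m) (U (Suc t))" using Q t by (simp add: quantum_network_def)
      \<comment> \<open>The unitary between queries does not depend on the input and so preserves
        the inner products; only the query can change them.\<close>
      have "ip (2 ^ m) (\<psi> X (Suc t)) (\<psi> Y (Suc t))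
          = ip (2 ^ m) (query_mat N m X *\<^sub>v \<psi> X t) (query_mat N m Y *\<^sub>v \<psi> Y t)" for Y
        using car by (simp add: \<psi>_def ip_unitary[OF U] mult_mat_vec_carrier[OF query_mat_carrier])
      then show "cmod (ip (2 ^ m) (\<psi> X (Suc t)) (\<psi> (X[i := True]) (Suc t)) - ip (2 ^ m) (\<psi> X t) (\<psi> (X[i := True]) t))
          \<le> a * query_mass N m (\<psi> X t) i + query_mass N m (\<psi> (X[i := True]) t) i / a"
        using ip_query_change[OF m car car _ a, of i X "X[i := True]" X "X[i := True]"] by simp
    qed
    also have "\<dots> = a * (\<Sum>X\<in>?S. \<Sum>i\<in>?Z X. query_mass N m (\<psi> X t) i)
        + (\<Sum>X\<in>?S. \<Sum>i\<in>?Z X. query_mass N m (\<psi> (X[i := True]) t) i) / a"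
      by (simp add: sum.distrib sum_distrib_left sum_divide_distrib)
    also have "(\<Sum>X\<in>?S. \<Sum>i\<in>?Z X. query_mass N m (\<psi> (X[i := True]) t) i)
        = (\<Sum>Y\<in>?S'. \<Sum>i | i < N \<and> Y ! i. query_mass N m (\<psi> Y t) i)"
      by (rule sum_flips)
    \<comment> \<open>The gain: the query masses of one state add up to at most 1, however many
      edges leave the input.\<close>
    also have "a * (\<Sum>X\<in>?S. \<Sum>i\<in>?Z X. query_mass N m (\<psi> X t) i)
        + (\<Sum>Y\<in>?S'. \<Sum>i | i < N \<and> Y ! i. query_mass N m (\<psi> Y t) i) / a
        \<le> a * real (card ?S) + real (card ?S') / a"
      using a by (intro add_mono mult_left_mono divide_right_mono sum_bounded_above[where K = "1 :: real", simplified] mass) auto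
    also have "real (card ?S) = E / real (N - k)" using k by (simp add: E_def)
    also have "real (card ?S') = E / real (k + 1)" by (simp add: E')
    \<comment> \<open>The choice of \<open>a\<close> makes both summands equal to
      \<open>E / r\<close>.\<close>
    also have "a * (E / real (N - k)) + E / real (k + 1) / a = 2 * E / r"
    proof -
      define p q where "p = sqrt (real (N - k))" and "q = sqrt (real (k + 1))"
      have "p > 0" "q > 0" "real (N - k) = p\<^sup>2" "real (k + 1) = q\<^sup>2" "a = p / q" "r = p * q"
        using k by (auto simp: p_def q_def a_def r_def real_sqrt_divide real_sqrt_mult)
      then show ?thesis by (simp add: field_simps power2_eq_square)
    qed
    finally show ?thesis .
  qed
  have W0: "W 0 = E"
  proof -
    have "\<psi> X 0 = \<psi> Y 0" for X Y by (simp add: \<psi>_def)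
    then have "ip (2 ^ m) (\<psi> X 0) (\<psi> Y 0) = 1" for X Y
      using ip_network_state[OF Q, of 0 X] by (metis \<psi>_def zero_le)
    then show ?thesis by (simp add: W_def E card_zeros)
  qed
  have "cmod (W t - W 0) \<le> real t * (2 * E / r)" if "t \<le> T" for t
    using that
  proof (induction t)
    case (Suc t)
    have "cmod (W (Suc t) - W 0) \<le> cmod (W (Suc t) - W t) + cmod (W t - W 0)"
      using norm_triangle_ineq[of "W (Suc t) - W t" "W t - W 0"] by simp
    moreover have "real (Suc t) * (2 * E / r) = 2 * E / r + real t * (2 * E / r)"
      by (simp only: of_nat_Suc distrib_right mult_1)
    ultimately show ?case using Suc step[of t] by linarith
  qed simp
  then have "cmod (W T - E) \<le> real T * (2 * E / r)" using W0 by simp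
  moreover have "cmod (W T) \<le> 17 / 18 * E"
  proof -
    have "cmod (W T) \<le> (\<Sum>X\<in>?S. \<Sum>i\<in>?Z X. 17 / 18)"
      unfolding W_def
    proof (intro order_trans[OF norm_sum] sum_mono)
      fix X i assume X: "X \<in> ?S" and i: "i \<in> ?Z X"
      let ?Y = "X[i := True]"
      have Y: "?Y \<in> ?S'" using X i flip_up by simp
      then have "f ?Y = (\<not> f X)" using f[OF X Y] by simp
      moreover have "output_prob N m T U X (f X) \<ge> 2 / 3" "output_prob N m T U ?Y (f ?Y) \<ge> 2 / 3"
        using C X Y by (auto simp: computes_bounded_error_def slice_def)
      ultimately show "cmod (ip (2 ^ m) (\<psi> X T) (\<psi> ?Y T)) \<le> 17 / 18"
        unfolding \<psi>_def by (intro ip_output_le[OF Q, of X "f X"]) auto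
    qed
    then show ?thesis by (simp add: E card_zeros)
  qed
  moreover have "E \<le> cmod (W T - E) + cmod (W T)"
    using norm_triangle_ineq4[of "W T" "W T - E"] E0 by simp
  ultimately have "E / 18 \<le> real T * (2 * E / r)" by linarith
  then have "r \<le> 36 * real T" using E0 r by (simp add: field_simps)
  then show ?thesis by (simp add: r_def)
qed

subsection \<open>Networks from dual adversary solutions\<close>

lemma sum_lessThan_mult:
  fixes g :: "nat \<Rightarrow> 'a::comm_monoid_add"
  shows "(\<Sum>s<a * b. g s) = (\<Sum>i<a. \<Sum>z<b. g (i * b + z))"
proof (induction a)
  case (Suc a)
  have "(\<Sum>s<Suc a * b. g s) = (\<Sum>s<a * b. g s) + (\<Sum>s\<in>{a * b..<a * b + b}. g s)"
    by (simp add: sum.lessThan_Suc ivl_disj_un_one(2) add.commute lessThan_atLeast0 sum.atLeastLessThan_concat)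
  also have "(\<Sum>s\<in>{a * b..<a * b + b}. g s) = (\<Sum>z<b. g (a * b + z))"
    using sum.shift_bounds_nat_ivl[of g 0 "a * b" b] by (simp add: lessThan_atLeast0 add.commute)
  finally show ?case using Suc by simp
qed simp

text \<open>
  A real vector indexed by \<open>|i,b,z\<rangle>\<close> whose \<open>b\<close>-register is in the state \<open>|+\<rangle>\<close> on the component
  \<open>P\<close> and in the state \<open>|-\<rangle>\<close> on the component \<open>V\<close> (both unnormalised). A query leaves
  \<open>P\<close> alone and multiplies \<open>V i\<close> by \<open>(-1)^x_i\<close>.
\<close>

definition pm_vec :: "nat \<Rightarrow> nat \<Rightarrow> (nat \<Rightarrow> nat \<Rightarrow> real) \<Rightarrow> (nat \<Rightarrow> nat \<Rightarrow> real) \<Rightarrow> real vec" where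
  "pm_vec n l P V = vec (2 ^ (n + 1 + l)) (\<lambda>s.
     P (s div 2 ^ (l + 1)) (s mod 2 ^ l) + (- 1) ^ (s div 2 ^ l mod 2) * V (s div 2 ^ (l + 1)) (s mod 2 ^ l))"

lemma pm_vec_carrier [simp]: "pm_vec n l P V \<in> carrier_vec (2 ^ (n + 1 + l))"
  by (simp add: pm_vec_def)

lemma sum_basis_states:
  fixes g :: "nat \<Rightarrow> 'a::comm_monoid_add"
  shows "(\<Sum>s<2 ^ (n + 1 + l). g s)
    = (\<Sum>i<2 ^ n. \<Sum>z<2 ^ l. g ((2 * i) * 2 ^ l + z) + g ((2 * i + 1) * 2 ^ l + z))"
proof -
  have "(\<Sum>s<2 ^ (n + 1 + l). g s) = (\<Sum>s<2 ^ n * 2 * 2 ^ l. g s)" by (simp add: power_add mult_ac)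
  also have "\<dots> = (\<Sum>i<2 ^ n. \<Sum>b<2. \<Sum>z<2 ^ l. g ((i * 2 + b) * 2 ^ l + z))"
    by (simp only: sum_lessThan_mult)
  also have "\<dots> = (\<Sum>i<2 ^ n. \<Sum>z<2 ^ l. g ((2 * i) * 2 ^ l + z) + g ((2 * i + 1) * 2 ^ l + z))"
    by (simp add: numeral_2_eq_2 sum.distrib mult.commute)
  finally show ?thesis .
qed

lemma pm_vec_index:
  assumes "i < 2 ^ n" "z < 2 ^ l" "b < 2"
  shows "pm_vec n l P V $ ((2 * i + b) * 2 ^ l + z) = P i z + (- 1) ^ b * V i z"
proof -
  note enc = div_mod_encoding[OF assms(3,2), of i]
  have "(2 * i + b) * 2 ^ l + z < 2 ^ (n + 1 + l)"
  proof -
    have "((2 * i + b) * 2 ^ l + z) div 2 ^ (l + 1) < 2 ^ n" unfolding enc by fact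
    then have "(2 * i + b) * 2 ^ l + z < 2 ^ n * 2 ^ (l + 1)" by (simp only: div_less_iff_less_mult zero_less_power pos2)
    then show ?thesis by (simp add: power_add mult_ac)
  qed
  then show ?thesis by (simp only: pm_vec_def index_vec enc)
qed

text \<open>The mixed products of \<open>P\<close> and \<open>V\<close> carry opposite signs for
  \<open>b = 0\<close> and \<open>b = 1\<close> and cancel; the others are counted twice.\<close>

lemma pm_vec_scalar_prod:
  "pm_vec n l P V \<bullet> pm_vec n l P' V'
    = 2 * (\<Sum>i<2 ^ n. \<Sum>z<2 ^ l. P i z * P' i z + V i z * V' i z)"
proof -
  have "pm_vec n l P V \<bullet> pm_vec n l P' V' = (\<Sum>s<2 ^ (n + 1 + l). pm_vec n l P V $ s * pm_vec n l P' V' $ s)"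
    by (simp add: scalar_prod_def lessThan_atLeast0 pm_vec_def)
  also have "\<dots> = (\<Sum>i<2 ^ n. \<Sum>z<2 ^ l. 2 * (P i z * P' i z + V i z * V' i z))"
    unfolding sum_basis_states
  proof (intro sum.cong refl)
    fix i z :: nat assume "i \<in> {..<2 ^ n}" "z \<in> {..<2 ^ l}"
    then show "pm_vec n l P V $ (2 * i * 2 ^ l + z) * pm_vec n l P' V' $ (2 * i * 2 ^ l + z) +
        pm_vec n l P V $ ((2 * i + 1) * 2 ^ l + z) * pm_vec n l P' V' $ ((2 * i + 1) * 2 ^ l + z) =
        2 * (P i z * P' i z + V i z * V' i z)"
      using pm_vec_index[of i n z l 0] pm_vec_index[of i n z l 1]
      by (simp del: mult_Suc_right add: ring_distribs)
  qed
  finally show ?thesis by (simp add: sum_distrib_left)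
qed

text \<open>Phase kickback: flipping the \<open>b\<close>-register fixes its \<open>|+>\<close> part
  and negates its \<open>|->\<close> part.\<close>

lemma query_pm_vec:
  fixes n l
  defines "m \<equiv> n + 1 + l"
  assumes n: "n = index_bits N"
  shows "query_mat N m X *\<^sub>v map_vec complex_of_real (pm_vec n l P V)
    = map_vec complex_of_real (pm_vec n l P (\<lambda>i z. (if i < N \<and> X ! i then -1 else 1) * V i z))"
    (is "_ = ?r")
proof (rule eq_vecI)
  have m: "index_bits N + 1 \<le> m" by (simp add: m_def n)
  have car: "map_vec complex_of_real (pm_vec n l P V) \<in> carrier_vec (2 ^ m)"
    unfolding m_def map_carrier_vec by (rule pm_vec_carrier)
  show "dim_vec (query_mat N m X *\<^sub>v map_vec complex_of_real (pm_vec n l P V)) = dim_vec ?r"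
    using query_mat_carrier[of N m X] by (simp add: m_def pm_vec_def)
  fix s assume "s < dim_vec ?r"
  then have s: "s < 2 ^ m" by (simp add: pm_vec_def m_def)
  define i where "i = s div 2 ^ (l + 1)"
  define b where "b = s div 2 ^ l mod 2"
  define z where "z = s mod 2 ^ l"
  have bz: "b < 2" "z < 2 ^ l" by (auto simp: b_def z_def)
  have "m - index_bits N = l + 1" by (simp add: m_def n)
  then have qi: "query_index N m s = i" by (simp add: query_index_def i_def)
  have i: "i < 2 ^ n" using s qi by (simp add: less_two_power_iff_query_index[OF m] n)
  have s_eq: "s = (2 * i + b) * 2 ^ l + z"
    unfolding i_def b_def z_def by (rule encoding_div_mod[symmetric])
  define b' where "b' = (if i < N then (b + of_bool (X ! i)) mod 2 else b)"
  have b': "b' < 2" using bz by (simp add: b'_def)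
  have l: "m - index_bits N - 1 = l" by (simp add: m_def n)
  have "query_state N m X s = (2 * i + b') * 2 ^ l + z"
    unfolding query_state_eq[OF m] qi l b'_def b_def[symmetric] z_def[symmetric]
    by (simp add: s_eq[symmetric])
  then have q: "(query_mat N m X *\<^sub>v map_vec complex_of_real (pm_vec n l P V)) $ s
      = map_vec complex_of_real (pm_vec n l P V) $ ((2 * i + b') * 2 ^ l + z)"
    and q_less: "(2 * i + b') * 2 ^ l + z < 2 ^ m"
    using query_mat_mult_vec[OF m car s, of X] query_state_less[OF m, of X s] s by simp_all
  have sign: "(- 1 :: real) ^ b' = (- 1) ^ b * (if i < N \<and> X ! i then -1 else 1)"
    using bz(1) by (cases "X ! i") (auto simp: b'_def less_2_cases_iff)
  have entry: "map_vec complex_of_real (pm_vec n l A B) $ r = complex_of_real (pm_vec n l A B $ r)"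
    if "r < 2 ^ m" for A B r
    using that by (subst index_map_vec) (simp_all add: m_def pm_vec_def)
  show "(query_mat N m X *\<^sub>v map_vec complex_of_real (pm_vec n l P V)) $ s = ?r $ s"
    unfolding q entry[OF q_less] entry[OF s] pm_vec_index[OF i bz(2) b']
    by (subst s_eq) (simp only: pm_vec_index[OF i bz(2) bz(1)] sign mult.assoc)
qed

lemma ip_of_real:
  assumes "x \<in> carrier_vec d" "y \<in> carrier_vec d"
  shows "ip d (map_vec complex_of_real x) (map_vec complex_of_real y) = complex_of_real (x \<bullet> y)"
  using assms by (simp add: ip_def scalar_prod_def lessThan_atLeast0)

lemma network_of_dual_solution:
  fixes v :: "bool list \<Rightarrow> nat \<Rightarrow> nat \<Rightarrow> real"
  assumes N: "N \<ge> 1" and K1: "K \<ge> 1"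
    and dual: "\<And>x y. x \<in> cube N \<Longrightarrow> y \<in> cube N \<Longrightarrow>
      2 * (\<Sum>i | i < N \<and> x ! i \<noteq> y ! i. \<Sum>z<Z. v x i z * v y i z) = of_bool (f x \<noteq> f y)"
    and W: "\<And>x. x \<in> cube N \<Longrightarrow> (\<Sum>i<N. \<Sum>z<Z. (v x i z)\<^sup>2) \<le> W"
    and K: "12 * W \<le> real K"
  shows "\<exists>m U. quantum_network N m K U \<and> computes_bounded_error N f m K U"
proof -
  define n where "n = index_bits N"
  \<comment> \<open>Large enough for \<open>2 * K\<close> and \<open>Z\<close> to fit below
    \<open>2 ^ l\<close>; also \<open>l \<ge> 1\<close>, so that the measured rightmost bit belongs
    to \<open>z\<close>.\<close>
  define l where "l = 2 * K + Z"
  define m where "m = n + 1 + l"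
  \<comment> \<open>\<open>K\<close> copies of amplitude \<open>c\<close> on the unnormalised
    \<open>|+>\<close> have squared norm \<open>2 * K * c^2 = 1\<close>. The same factor scales the
    catalyst, whose squared norm becomes at most \<open>W / K\<close>.\<close>
  define c where "c = 1 / sqrt (2 * real K)"
  \<comment> \<open>Copy \<open>s\<close> occupies \<open>z = 2 * s\<close> and
    \<open>z = 2 * s + 1\<close>; the lowest bit is its output bit. After \<open>t\<close> queries
    the copies \<open>s < t\<close> hold \<open>f x\<close> and the others still hold 0.\<close>
  define p where "p x t z = (if z < K * 2 \<and> odd z = (z div 2 < t \<and> f x) then c else 0)" for x t z
  define P where "P x t i z = (if i = (0::nat) then p x t z else 0)" for x t i z
  define V where "V x i z = (if i < N \<and> z < Z then c * v x i z else 0)" for x i z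
  define sg where "sg x i = (if i < N \<and> x ! i then -1 else 1 :: real)" for x i
  \<comment> \<open>\<open>\<Psi> x t\<close> is the ideal state after \<open>t\<close> rounds with
    the catalyst present, \<open>\<Phi> x t\<close> the same state after the next query, and
    \<open>E x\<close> the catalyst alone.\<close>
  define \<Psi> where "\<Psi> x t = pm_vec n l (P x t) (V x)" for x t
  define \<Phi> where "\<Phi> x t = pm_vec n l (P x t) (\<lambda>i z. sg x i * V x i z)" for x t
  define E where "E x = pm_vec n l (\<lambda>_ _. 0) (V x)" for x
  have m: "index_bits N + 1 \<le> m" by (simp add: m_def n_def)
  have c2: "c\<^sup>2 = 1 / (2 * real K)" by (simp add: c_def power_divide)
  have Nn: "N \<le> 2 ^ n" using le_two_power_index_bits[OF N] by (simp add: n_def)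
  have "l < 2 ^ l" by (rule less_exp)
  moreover have "K * 2 \<le> l" "Z \<le> l" "l \<ge> 1" using K1 by (simp_all add: l_def)
  ultimately have l: "K * 2 \<le> 2 ^ l" "Z \<le> 2 ^ l" "l \<ge> 1" by linarith+
  have car: "\<Psi> x t \<in> carrier_vec (2 ^ m)" "\<Phi> x t \<in> carrier_vec (2 ^ m)" "E x \<in> carrier_vec (2 ^ m)" for x t
    unfolding \<Psi>_def \<Phi>_def E_def m_def by (rule pm_vec_carrier)+
  \<comment> \<open>Unconverted copies agree for all inputs; each of the \<open>t\<close> converted
    ones is orthogonal for \<open>x\<close> and \<open>y\<close> exactly if the answers
    differ.\<close>
  have pp: "(\<Sum>z<2 ^ l. p x t z * p y t z) = c\<^sup>2 * (real K - real t * of_bool (f x \<noteq> f y))"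
    if t: "t \<le> K" for x y t
  proof -
    have "(\<Sum>z<2 ^ l. p x t z * p y t z) = (\<Sum>z<K * 2. p x t z * p y t z)"
      using l by (intro sum.mono_neutral_right) (auto simp: p_def)
    also have "\<dots> = (\<Sum>s<K. \<Sum>b<2. p x t (s * 2 + b) * p y t (s * 2 + b))"
      by (rule sum_lessThan_mult)
    also have "\<dots> = (\<Sum>s<K. c\<^sup>2 - (if s < t then c\<^sup>2 * of_bool (f x \<noteq> f y) else 0))"
    proof (intro sum.cong refl)
      fix s assume "s \<in> {..<K}"
      then have "p w t (s * 2) = (if s < t \<and> f w then 0 else c)"
        "p w t (s * 2 + 1) = (if s < t \<and> f w then c else 0)" for w
        by (auto simp: p_def)
      moreover have "(\<Sum>b<2. p x t (s * 2 + b) * p y t (s * 2 + b))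
          = p x t (s * 2) * p y t (s * 2) + p x t (s * 2 + 1) * p y t (s * 2 + 1)"
        by (simp add: lessThan_nat_numeral lessThan_Suc add.commute)
      ultimately show "(\<Sum>b<2. p x t (s * 2 + b) * p y t (s * 2 + b))
          = c\<^sup>2 - (if s < t then c\<^sup>2 * of_bool (f x \<noteq> f y) else 0)"
        by (auto simp: power2_eq_square)
    qed
    also have "\<dots> = real K * c\<^sup>2 - (\<Sum>s<K. if s < t then c\<^sup>2 * of_bool (f x \<noteq> f y) else 0)"
      by (simp add: sum_subtractf)
    also have "(\<Sum>s<K. if s < t then c\<^sup>2 * of_bool (f x \<noteq> f y) else 0)
        = (\<Sum>s<t. c\<^sup>2 * of_bool (f x \<noteq> f y))"
      using t by (intro sum.mono_neutral_cong_right) (auto split: if_splits)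
    finally show ?thesis by (simp add: algebra_simps)
  qed
  have PP: "(\<Sum>i<2 ^ n. \<Sum>z<2 ^ l. P x t i z * P y t i z) = c\<^sup>2 * (real K - real t * of_bool (f x \<noteq> f y))"
    if "t \<le> K" for x y t
  proof -
    have "(\<Sum>i<2 ^ n. \<Sum>z<2 ^ l. P x t i z * P y t i z)
        = (\<Sum>i<(2::nat) ^ n. if i = 0 then \<Sum>z<2 ^ l. p x t z * p y t z else 0)"
      by (intro sum.cong) (auto simp: P_def)
    then show ?thesis using pp[OF that] by simp
  qed
  have VV: "(\<Sum>i<2 ^ n. \<Sum>z<2 ^ l. g i * (V x i z * V y i z)) = c\<^sup>2 * (\<Sum>i<N. g i * (\<Sum>z<Z. v x i z * v y i z))"
    for g x y
  proof -
    have "(\<Sum>i<2 ^ n. \<Sum>z<2 ^ l. g i * (V x i z * V y i z)) = (\<Sum>i<N. \<Sum>z<2 ^ l. g i * (V x i z * V y i z))"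
      using Nn by (intro sum.mono_neutral_right) (auto simp: V_def)
    also have "\<dots> = (\<Sum>i<N. \<Sum>z<Z. g i * (V x i z * V y i z))"
      using l by (intro sum.cong refl sum.mono_neutral_right) (auto simp: V_def)
    also have "\<dots> = (\<Sum>i<N. \<Sum>z<Z. c\<^sup>2 * (g i * (v x i z * v y i z)))"
      by (intro sum.cong refl) (auto simp: V_def power2_eq_square)
    finally show ?thesis by (simp add: sum_distrib_left)
  qed
  \<comment> \<open>On the catalyst the query changes the sign of the terms with
    \<open>x ! i \<noteq> y ! i\<close>. By the dual condition this lowers the Gram entry exactly as
    much as converting one more copy does.\<close>
  have gram: "\<Phi> x t \<bullet> \<Phi> y t = \<Psi> x (Suc t) \<bullet> \<Psi> y (Suc t)"
    if x: "x \<in> cube N" and y: "y \<in> cube N" and t: "t < K" for x y t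
  proof -
    let ?w = "\<lambda>i. \<Sum>z<Z. v x i z * v y i z"
    have "\<Phi> x t \<bullet> \<Phi> y t = 2 * ((\<Sum>i<2 ^ n. \<Sum>z<2 ^ l. P x t i z * P y t i z)
        + (\<Sum>i<2 ^ n. \<Sum>z<2 ^ l. (sg x i * sg y i) * (V x i z * V y i z)))"
      unfolding \<Phi>_def pm_vec_scalar_prod sum.distrib by (simp add: mult_ac)
    moreover have "\<Psi> x (Suc t) \<bullet> \<Psi> y (Suc t) = 2 * ((\<Sum>i<2 ^ n. \<Sum>z<2 ^ l. P x (Suc t) i z * P y (Suc t) i z)
        + (\<Sum>i<2 ^ n. \<Sum>z<2 ^ l. 1 * (V x i z * V y i z)))"
      unfolding \<Psi>_def pm_vec_scalar_prod sum.distrib by simp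
    moreover have "(\<Sum>i<N. 1 * ?w i) - (\<Sum>i<N. (sg x i * sg y i) * ?w i) = of_bool (f x \<noteq> f y)"
    proof -
      have "(\<Sum>i<N. 1 * ?w i) - (\<Sum>i<N. (sg x i * sg y i) * ?w i) = (\<Sum>i<N. if x ! i \<noteq> y ! i then 2 * ?w i else 0)"
        unfolding sum_subtractf[symmetric] by (intro sum.cong) (auto simp: sg_def)
      also have "\<dots> = (\<Sum>i | i < N \<and> x ! i \<noteq> y ! i. 2 * ?w i)"
        by (intro sum.mono_neutral_cong_right) auto
      finally show ?thesis using dual[OF x y] by (simp add: sum_distrib_left)
    qed
    ultimately show ?thesis using t by (simp only: PP VV Suc_leI less_imp_le) (simp add: algebra_simps)
  qed
  have query: "query_mat N m x *\<^sub>v map_vec complex_of_real (\<Psi> x t) = map_vec complex_of_real (\<Phi> x t)" for x t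
    unfolding \<Psi>_def \<Phi>_def m_def sg_def by (rule query_pm_vec) (rule n_def)
  have "\<exists>G. \<forall>t. t < K \<longrightarrow> unitary_mat (2 ^ m) (G t) \<and>
     (\<forall>x\<in>cube N. G t *\<^sub>v map_vec complex_of_real (\<Phi> x t) = map_vec complex_of_real (\<Psi> x (Suc t)))"
  proof (rule choice, rule allI)
    fix t
    show "\<exists>G. t < K \<longrightarrow> unitary_mat (2 ^ m) G \<and>
      (\<forall>x\<in>cube N. G *\<^sub>v map_vec complex_of_real (\<Phi> x t) = map_vec complex_of_real (\<Psi> x (Suc t)))"
      using unitary_mat_of_equal_gram[of "cube N" "\<lambda>x. \<Phi> x t" "2 ^ m" "\<lambda>x. \<Psi> x (Suc t)"]
        finite_cube car gram by blast
  qed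
  then obtain G where G: "\<And>t. t < K \<Longrightarrow> unitary_mat (2 ^ m) (G t)"
    "\<And>t x. t < K \<Longrightarrow> x \<in> cube N \<Longrightarrow>
      G t *\<^sub>v map_vec complex_of_real (\<Phi> x t) = map_vec complex_of_real (\<Psi> x (Suc t))"
    by blast
  \<comment> \<open>The real start omits the catalyst. The argument \<open>[]\<close> is a dummy:
    for \<open>t = 0\<close> no copy depends on the input.\<close>
  define S0 where "S0 = pm_vec n l (P [] 0) (\<lambda>_ _. 0)"
  have S0c: "S0 \<in> carrier_vec (2 ^ m)" unfolding S0_def m_def by (rule pm_vec_carrier)
  have "S0 \<bullet> S0 = 1"
    using PP[of 0 "[]" "[]"] K1 by (simp add: S0_def pm_vec_scalar_prod c2)
  then obtain U0 where U0: "unitary_mat (2 ^ m) U0"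
    "U0 *\<^sub>v map_vec complex_of_real (unit_vec (2 ^ m) 0) = map_vec complex_of_real S0"
    using unitary_mat_of_equal_gram[of "{()}" "\<lambda>_. unit_vec (2 ^ m) 0" "2 ^ m" "\<lambda>_. S0"] S0c by auto
  define U where "U t = (case t of 0 \<Rightarrow> U0 | Suc t \<Rightarrow> G t)" for t
  have Q: "quantum_network N m K U"
    using G(1) U0(1) m by (auto simp: quantum_network_def U_def split: nat.split)
  have EE: "E x \<bullet> E x \<le> W / real K" if x: "x \<in> cube N" for x
  proof -
    have "E x \<bullet> E x = 2 * (\<Sum>i<2 ^ n. \<Sum>z<2 ^ l. 1 * (V x i z * V x i z))"
      by (simp add: E_def pm_vec_scalar_prod)
    also have "\<dots> = (\<Sum>i<N. \<Sum>z<Z. (v x i z)\<^sup>2) / real K"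
      unfolding VV c2 by (simp add: power2_eq_square)
    also have "\<dots> \<le> W / real K" using W[OF x] by (rule divide_right_mono) simp
    finally show ?thesis .
  qed
  \<comment> \<open>True and ideal states pass through the same unitaries, so their difference keeps
    the norm of the missing catalyst; errors do not accumulate over the rounds.\<close>
  have err: "ip (2 ^ m) (network_state N m U x t - map_vec complex_of_real (\<Psi> x t))
      (network_state N m U x t - map_vec complex_of_real (\<Psi> x t)) = complex_of_real (E x \<bullet> E x)"
    if x: "x \<in> cube N" and "t \<le> K" for x t
    using that(2)
  proof (induction t)
    case 0
    have "map_vec complex_of_real (unit_vec (2 ^ m) 0) = unit_vec (2 ^ m) 0"
      by (rule eq_vecI) auto
    then have start: "network_state N m U x 0 = map_vec complex_of_real S0"
      using U0(2) by (simp add: U_def)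
    have P0: "P x 0 = P [] 0" by (simp add: P_def p_def fun_eq_iff)
    have "ip (2 ^ m) (map_vec complex_of_real S0 - map_vec complex_of_real (\<Psi> x 0))
      (map_vec complex_of_real S0 - map_vec complex_of_real (\<Psi> x 0))
      = ip (2 ^ m) (map_vec complex_of_real (E x)) (map_vec complex_of_real (E x))"
      unfolding ip_def
    proof (intro sum.cong refl)
      fix s assume "s \<in> {..<(2::nat) ^ m}"
      then have s: "s < 2 ^ m" "s < 2 ^ (n + 1 + l)" by (auto simp: m_def)
      have "S0 $ s - \<Psi> x 0 $ s = - E x $ s"
        using s by (simp add: S0_def \<Psi>_def E_def pm_vec_def P0)
      then have "(map_vec complex_of_real S0 - map_vec complex_of_real (\<Psi> x 0)) $ s = - (map_vec complex_of_real (E x) $ s)"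
        using s car(1)[of x 0] car(3)[of x] S0c by (simp add: of_real_diff[symmetric] del: of_real_diff)
      then show "(map_vec complex_of_real S0 - map_vec complex_of_real (\<Psi> x 0)) $ s *
         cnj ((map_vec complex_of_real S0 - map_vec complex_of_real (\<Psi> x 0)) $ s) =
         map_vec complex_of_real (E x) $ s * cnj (map_vec complex_of_real (E x) $ s)" by simp
    qed
    then show ?case by (simp only: start ip_of_real[OF car(3) car(3)])
  next
    case (Suc t)
    then have t: "t < K" by simp
    let ?O = "query_mat N m x" and ?\<psi> = "network_state N m U x t" and ?\<Psi> = "map_vec complex_of_real (\<Psi> x t)"
    have \<psi>: "?\<psi> \<in> carrier_vec (2 ^ m)" using network_state_carrier[OF Q] t by simp
    have \<Psi>: "?\<Psi> \<in> carrier_vec (2 ^ m)" unfolding map_carrier_vec by (rule car(1))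
    have Uc: "G t \<in> carrier_mat (2 ^ m) (2 ^ m)" using G(1)[OF t] by (simp add: unitary_mat_def)
    have "G t *\<^sub>v (?O *\<^sub>v (?\<psi> - ?\<Psi>)) = G t *\<^sub>v (?O *\<^sub>v ?\<psi> - ?O *\<^sub>v ?\<Psi>)"
      by (simp only: mult_minus_distrib_mat_vec[OF query_mat_carrier \<psi> \<Psi>])
    also have "\<dots> = G t *\<^sub>v (?O *\<^sub>v ?\<psi>) - G t *\<^sub>v (?O *\<^sub>v ?\<Psi>)"
      by (rule mult_minus_distrib_mat_vec[OF Uc mult_mat_vec_carrier[OF query_mat_carrier \<psi>]
            mult_mat_vec_carrier[OF query_mat_carrier \<Psi>]])
    also have "\<dots> = network_state N m U x (Suc t) - map_vec complex_of_real (\<Psi> x (Suc t))"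
      by (simp only: query G(2)[OF t x]) (simp add: U_def)
    finally have "network_state N m U x (Suc t) - map_vec complex_of_real (\<Psi> x (Suc t))
      = G t *\<^sub>v (?O *\<^sub>v (?\<psi> - ?\<Psi>))" ..
    moreover have "?\<psi> - ?\<Psi> \<in> carrier_vec (2 ^ m)" using \<psi> \<Psi> by simp
    ultimately show ?case
      using Suc ip_unitary[OF G(1)[OF t] mult_mat_vec_carrier[OF query_mat_carrier] mult_mat_vec_carrier[OF query_mat_carrier]]
        ip_query[OF m] by simp
  qed
  have "output_prob N m K U x (f x) \<ge> 2 / 3" if x: "x \<in> cube N" for x
  proof -
    let ?\<psi> = "network_state N m U x K"
    let ?B = "{s :: nat. s < 2 ^ m \<and> odd s = (\<not> f x)}"
    let ?\<delta> = "\<lambda>s. cmod ((?\<psi> - map_vec complex_of_real (\<Psi> x K)) $ s)"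
    have \<psi>: "?\<psi> \<in> carrier_vec (2 ^ m)" using network_state_carrier[OF Q] by simp
    have "output_prob N m K U x (\<not> f x) = (\<Sum>s\<in>?B. (cmod (?\<psi> $ s))\<^sup>2)"
      by (simp add: output_prob_def)
    also have "\<dots> \<le> (\<Sum>s\<in>?B. 2 * (?\<delta> s)\<^sup>2 + 2 * (E x $ s)\<^sup>2)"
    proof (rule sum_mono)
      fix s assume s: "s \<in> ?B"
      then have s': "s < 2 ^ (n + 1 + l)" by (simp add: m_def)
      \<comment> \<open>After \<open>K\<close> rounds every copy holds \<open>f x\<close>, so on
        basis states with the wrong output bit the ideal state consists of the catalyst
        only.\<close>
      have "even (s mod 2 ^ l) = even s" using l(3) by (simp add: dvd_mod_iff)
      then have "P x K (s div 2 ^ (l + 1)) (s mod 2 ^ l) = 0"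
        using s by (auto simp: P_def p_def)
      then have E: "\<Psi> x K $ s = E x $ s"
        using s' by (simp add: \<Psi>_def E_def pm_vec_def)
      have "?\<psi> $ s = (?\<psi> - map_vec complex_of_real (\<Psi> x K)) $ s + complex_of_real (E x $ s)"
        using s \<psi> car(1)[of x K] E by simp
      then have "cmod (?\<psi> $ s) \<le> ?\<delta> s + \<bar>E x $ s\<bar>"
        using norm_triangle_ineq by (metis norm_of_real)
      then have "(cmod (?\<psi> $ s))\<^sup>2 \<le> (?\<delta> s + \<bar>E x $ s\<bar>)\<^sup>2" by (intro power_mono) auto
      also have "\<dots> \<le> 2 * (?\<delta> s)\<^sup>2 + 2 * (E x $ s)\<^sup>2"
        using sum_squares_bound[of "?\<delta> s" "\<bar>E x $ s\<bar>"] by (simp add: power2_sum)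
      finally show "(cmod (?\<psi> $ s))\<^sup>2 \<le> 2 * (?\<delta> s)\<^sup>2 + 2 * (E x $ s)\<^sup>2" .
    qed
    also have "\<dots> \<le> (\<Sum>s<2 ^ m. 2 * (?\<delta> s)\<^sup>2 + 2 * (E x $ s)\<^sup>2)"
      by (intro sum_mono2) auto
    also have "\<dots> = 2 * (\<Sum>s<2 ^ m. (?\<delta> s)\<^sup>2) + 2 * (\<Sum>s<2 ^ m. (E x $ s)\<^sup>2)"
      by (simp add: sum.distrib sum_distrib_left)
    also have "(\<Sum>s<2 ^ m. (?\<delta> s)\<^sup>2) = E x \<bullet> E x"
      using err[OF x order_refl] unfolding ip_self by (simp only: of_real_eq_iff)
    also have "(\<Sum>s<2 ^ m. (E x $ s)\<^sup>2) = E x \<bullet> E x"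
      using car(3)[of x] by (simp add: scalar_prod_def lessThan_atLeast0 power2_eq_square)
    \<comment> \<open>The deviation from the ideal state and the catalyst in it contribute
      \<open>2 * W / K\<close> each; \<open>12 * W \<le> K\<close> is what brings the sum down to
      \<open>1/3\<close>.\<close>
    also have "2 * (E x \<bullet> E x) + 2 * (E x \<bullet> E x) \<le> 4 * (W / real K)" using EE[OF x] by simp
    also have "\<dots> \<le> 1 / 3" using K K1 by (simp add: field_simps)
    finally show ?thesis using output_prob_add[OF Q, of x "f x"] by linarith
  qed
  then show ?thesis using Q by (auto simp: computes_bounded_error_def)
qed

subsection \<open>Symmetric functions\<close>

text \<open>
  The dual solution is the matrix \<open>[g k \<noteq> g l] / (k - l)\<close>, whose rows are square summable like
  those of the Hilbert matrix. Entries with an index below \<open>t\<close> are factored through their rows and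
  the others through their columns, so that the long vectors meet few ones or few zeros of the input.
\<close>

lemma symmetric_dual_solution:
  fixes g :: "nat \<Rightarrow> bool"
  assumes f: "\<And>x. x \<in> cube N \<Longrightarrow> f x = g (hamming_weight x)"
    and mid: "\<And>k l. t \<le> k \<Longrightarrow> k + t \<le> N \<Longrightarrow> t \<le> l \<Longrightarrow> l + t \<le> N \<Longrightarrow> g k = g l"
    and t: "t \<ge> 1" and N: "N \<ge> 1"
  shows "\<exists>(v :: bool list \<Rightarrow> nat \<Rightarrow> nat \<Rightarrow> real) Z.
    (\<forall>x\<in>cube N. \<forall>y\<in>cube N.
      2 * (\<Sum>i | i < N \<and> x ! i \<noteq> y ! i. \<Sum>z<Z. v x i z * v y i z) = of_bool (f x \<noteq> f y)) \<and>
    (\<forall>x\<in>cube N. (\<Sum>i<N. \<Sum>z<Z. (v x i z)\<^sup>2) \<le> 17 * sqrt (real N * real t))"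
proof -
  define \<alpha> where "\<alpha> k l = (if g k \<noteq> g l then 1 / (real k - real l) else 0)" for k l
  define lo where "lo k l = (if k < t \<or> l < t then \<alpha> k l else 0)" for k l
  define hi where "hi k l = (if k < t \<or> l < t then 0 else \<alpha> k l)" for k l
  \<comment> \<open>The fourth root of \<open>N / t\<close> balances the matrix part of the cost, of
    order \<open>t * c^2\<close>, against the unit vectors, of order \<open>N / c^2\<close>: both
    become \<open>sqrt (N * t)\<close>.\<close>
  define c where "c = sqrt (sqrt (real N / real t))"
  \<comment> \<open>Chosen so that \<open>A k\<close> and \<open>B l\<close> have inner product
    \<open>\<alpha> k l / 2\<close>. Coordinates up to \<open>N\<close> pair row \<open>k\<close> of
    \<open>lo\<close> with the unit vector of \<open>l\<close>; the next \<open>N + 1\<close> pair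
    the unit vector of \<open>k\<close> with column \<open>l\<close> of \<open>hi\<close>. As
    \<open>A\<close> sits at ones and \<open>B\<close> at zeros, they meet wherever two inputs
    differ.\<close>
  define A where "A k z = (if z \<le> N then c * lo k z else of_bool (z = N + 1 + k) / (2 * c))" for k z
  define B where "B l z = (if z \<le> N then of_bool (z = l) / (2 * c) else c * hi (z - (N + 1)) l)" for l z
  define v where "v x i z = (if x ! i then A (hamming_weight x) z else B (hamming_weight x) z)" for x i z
  define Z where "Z = 2 * (N + 1)"
  have c: "c > 0" "c\<^sup>2 = sqrt (real N / real t)" using t N by (auto simp: c_def)
  have wt: "hamming_weight x \<le> N" and len: "length x = N" if "x \<in> cube N" for x
  proof -
    show "length x = N" using that by (simp add: cube_def)
    then have "{i. i < length x \<and> x ! i} \<subseteq> {..<N}" by auto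
    then show "hamming_weight x \<le> N"
      using card_mono[of "{..<N}"] unfolding hamming_weight_eq_card by fastforce
  qed
  have split: "(\<Sum>z<Z. h z) = (\<Sum>z\<le>N. h z) + (\<Sum>z\<le>N. h (N + 1 + z))" for h :: "nat \<Rightarrow> real"
    unfolding Z_def sum_lessThan_mult by (simp add: lessThan_nat_numeral lessThan_Suc_atMost)
  have AB: "(\<Sum>z<Z. A k z * B l z) = \<alpha> k l / 2" if "k \<le> N" "l \<le> N" for k l
  proof -
    have "(\<Sum>z\<le>N. A k z * B l z) = (\<Sum>z\<le>N. if z = l then lo k z / 2 else 0)"
      using c by (intro sum.cong) (auto simp: A_def B_def)
    moreover have "(\<Sum>z\<le>N. A k (N + 1 + z) * B l (N + 1 + z)) = (\<Sum>z\<le>N. if z = k then hi z l / 2 else 0)"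
      using c by (intro sum.cong) (auto simp: A_def B_def)
    ultimately show ?thesis using that by (simp add: split lo_def hi_def)
  qed
  have AA: "(\<Sum>z<Z. (A k z)\<^sup>2) = c\<^sup>2 * (\<Sum>z\<le>N. (lo k z)\<^sup>2) + 1 / (4 * c\<^sup>2)" if "k \<le> N" for k
  proof -
    have "(\<Sum>z\<le>N. (A k z)\<^sup>2) = c\<^sup>2 * (\<Sum>z\<le>N. (lo k z)\<^sup>2)"
      by (simp add: A_def power_mult_distrib sum_distrib_left)
    moreover have "(\<Sum>z\<le>N. (A k (N + 1 + z))\<^sup>2) = (\<Sum>z\<le>N. if z = k then 1 / (4 * c\<^sup>2) else 0)"
      by (intro sum.cong) (auto simp: A_def power_divide power_mult_distrib)
    ultimately show ?thesis using that by (simp add: split)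
  qed
  have BB: "(\<Sum>z<Z. (B k z)\<^sup>2) = c\<^sup>2 * (\<Sum>z\<le>N. (hi z k)\<^sup>2) + 1 / (4 * c\<^sup>2)" if "k \<le> N" for k
  proof -
    have "(\<Sum>z\<le>N. (B k (N + 1 + z))\<^sup>2) = c\<^sup>2 * (\<Sum>z\<le>N. (hi z k)\<^sup>2)"
      by (simp add: B_def power_mult_distrib sum_distrib_left)
    moreover have "(\<Sum>z\<le>N. (B k z)\<^sup>2) = (\<Sum>z\<le>N. if z = k then 1 / (4 * c\<^sup>2) else 0)"
      by (intro sum.cong) (auto simp: B_def power_divide power_mult_distrib)
    ultimately show ?thesis using that by (simp add: split)
  qed
  have lo_le: "real k * (\<Sum>z\<le>N. (lo k z)\<^sup>2) \<le> 8 * real t" for k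
    using t by (intro weighted_square_sum_le) (auto simp: lo_def \<alpha>_def power_divide)
  \<comment> \<open>Reflecting both indices by \<open>z \<mapsto> N - z\<close> turns the upper end
    into the lower one; \<open>mid\<close> then kills the entries with both indices in the middle.
    The guard \<open>z \<le> N\<close> is there because natural subtraction truncates.\<close>
  have hi_le: "real (N - k) * (\<Sum>z\<le>N. (hi z k)\<^sup>2) \<le> 8 * real t" if k: "k \<le> N" for k
  proof -
    have "(\<Sum>z\<le>N. (hi z k)\<^sup>2) = (\<Sum>z\<le>N. (hi (N - z) k)\<^sup>2)"
      by (rule sum.reindex_bij_witness[of _ "\<lambda>z. N - z" "\<lambda>z. N - z"]) auto
    also have "\<dots> = (\<Sum>z\<le>N. (if z \<le> N then hi (N - z) k else 0)\<^sup>2)"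
      by (intro sum.cong) auto
    also have "real (N - k) * \<dots> \<le> 8 * real t"
    proof (rule weighted_square_sum_le[OF _ _ t])
      fix z
      have "(real (N - z) - real k)\<^sup>2 = (real (N - k) - real z)\<^sup>2" if "z \<le> N"
        using that k by (simp add: of_nat_diff algebra_simps)
      then show "(if z \<le> N then hi (N - z) k else 0)\<^sup>2 \<le> 1 / (real (N - k) - real z)\<^sup>2"
        by (auto simp: hi_def \<alpha>_def power_divide)
    next
      fix z assume "t \<le> N - k" "t \<le> z"
      then show "(if z \<le> N then hi (N - z) k else 0) = 0"
        using mid[of "N - z" k] k t by (auto simp: hi_def \<alpha>_def)
    qed
    finally show ?thesis .
  qed
  have dual: "2 * (\<Sum>i | i < N \<and> x ! i \<noteq> y ! i. \<Sum>z<Z. v x i z * v y i z) = of_bool (f x \<noteq> f y)"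
    if x: "x \<in> cube N" and y: "y \<in> cube N" for x y
  proof -
    let ?k = "hamming_weight x" and ?l = "hamming_weight y"
    have ones: "(\<Sum>i<N. of_bool (w ! i)) = real (hamming_weight w)" if "w \<in> cube N" for w
    proof -
      have "(\<Sum>i<N. of_bool (w ! i)) = (\<Sum>i | i < N \<and> w ! i. 1 :: real)"
        by (intro sum.mono_neutral_cong_right) auto
      then show ?thesis using len[OF that] by (simp add: hamming_weight_eq_card)
    qed
    \<comment> \<open>Antisymmetry turns each differing position into
      \<open>(x_i - y_i) * \<alpha> k l / 2\<close>. These add up to
      \<open>(k - l) * \<alpha> k l / 2\<close>, which cancels the denominator of
      \<open>\<alpha>\<close>.\<close>
    have anti: "\<alpha> ?l ?k = - \<alpha> ?k ?l"
      by (cases "?k = ?l") (auto simp: \<alpha>_def field_simps)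
    have "(\<Sum>i | i < N \<and> x ! i \<noteq> y ! i. \<Sum>z<Z. v x i z * v y i z)
        = (\<Sum>i | i < N \<and> x ! i \<noteq> y ! i. (of_bool (x ! i) - of_bool (y ! i)) * (\<alpha> ?k ?l / 2))"
    proof (intro sum.cong refl)
      fix i assume i: "i \<in> {i. i < N \<and> x ! i \<noteq> y ! i}"
      have "(\<Sum>z<Z. B ?k z * A ?l z) = (\<Sum>z<Z. A ?l z * B ?k z)"
        by (simp only: mult.commute)
      then show "(\<Sum>z<Z. v x i z * v y i z) = (of_bool (x ! i) - of_bool (y ! i)) * (\<alpha> ?k ?l / 2)"
        using i AB[OF wt[OF x] wt[OF y]] AB[OF wt[OF y] wt[OF x]] anti by (cases "x ! i") (auto simp: v_def)
    qed
    also have "\<dots> = (\<Sum>i<N. (of_bool (x ! i) - of_bool (y ! i)) * (\<alpha> ?k ?l / 2))"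
      by (intro sum.mono_neutral_left) auto
    also have "\<dots> = (real ?k - real ?l) * (\<alpha> ?k ?l / 2)"
      by (simp only: sum_distrib_right[symmetric] sum_subtractf ones x y)
    also have "\<dots> = of_bool (f x \<noteq> f y) / 2"
      by (cases "?k = ?l") (auto simp: \<alpha>_def f[OF x] f[OF y])
    finally show ?thesis by simp
  qed
  have cost: "(\<Sum>i<N. \<Sum>z<Z. (v x i z)\<^sup>2) \<le> 17 * sqrt (real N * real t)" if x: "x \<in> cube N" for x
  proof -
    let ?k = "hamming_weight x"
    have xs: "x \<in> slice N ?k" using x by (simp add: slice_def)
    have "(\<Sum>i<N. \<Sum>z<Z. (v x i z)\<^sup>2)
        = (\<Sum>i\<in>{i. i < N \<and> x ! i} \<union> {i. i < N \<and> \<not> x ! i}. \<Sum>z<Z. (v x i z)\<^sup>2)"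
      by (intro sum.cong) auto
    also have "\<dots> = (\<Sum>i | i < N \<and> x ! i. \<Sum>z<Z. (A ?k z)\<^sup>2) + (\<Sum>i | i < N \<and> \<not> x ! i. \<Sum>z<Z. (B ?k z)\<^sup>2)"
      by (subst sum.union_disjoint) (auto simp: v_def)
    \<comment> \<open>Ones pay only for \<open>A\<close> and zeros only for \<open>B\<close>:
      exactly the weights \<open>k\<close> and \<open>N - k\<close> of \<open>lo_le\<close> and
      \<open>hi_le\<close>.\<close>
    also have "\<dots> = real ?k * (\<Sum>z<Z. (A ?k z)\<^sup>2) + real (N - ?k) * (\<Sum>z<Z. (B ?k z)\<^sup>2)"
      by (simp only: sum_constant card_ones[OF xs] card_zeros[OF xs])
    also have "\<dots> = c\<^sup>2 * (real ?k * (\<Sum>z\<le>N. (lo ?k z)\<^sup>2)) + c\<^sup>2 * (real (N - ?k) * (\<Sum>z\<le>N. (hi z ?k)\<^sup>2))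
        + (real ?k + real (N - ?k)) / (4 * c\<^sup>2)"
      by (simp only: AA[OF wt[OF x]] BB[OF wt[OF x]]) (simp add: algebra_simps add_divide_distrib)
    also have "\<dots> \<le> c\<^sup>2 * (8 * real t) + c\<^sup>2 * (8 * real t) + (real ?k + real (N - ?k)) / (4 * c\<^sup>2)"
      by (intro add_mono mult_left_mono lo_le hi_le wt x) auto
    also have "\<dots> = 16 * (real t * c\<^sup>2) + (real N / c\<^sup>2) / 4"
      using wt[OF x] by (simp add: of_nat_diff)
    also have "real t * c\<^sup>2 = sqrt (real N * real t)"
    proof -
      have "real t * c\<^sup>2 = sqrt ((real t)\<^sup>2 * (real N / real t))"
        unfolding real_sqrt_mult c(2) by simp
      then show ?thesis using t by (simp add: power2_eq_square mult.commute)
    qed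
    also have "real N / c\<^sup>2 = sqrt (real N * real t)"
    proof -
      have "real N / c\<^sup>2 = sqrt ((real N)\<^sup>2 / (real N / real t))"
        unfolding real_sqrt_divide[of "(real N)\<^sup>2"] c(2) by simp
      then show ?thesis using N by (simp add: power2_eq_square)
    qed
    also have "16 * sqrt (real N * real t) + sqrt (real N * real t) / 4 \<le> 17 * sqrt (real N * real t)"
      by simp
    finally show ?thesis .
  qed
  show ?thesis using dual cost by blast
qed

section \<open>Jumps of the value sequence and the resulting network\<close>

lemma weight_value_eq:
  assumes "symmetric_on_cube N f" "X \<in> cube N"
  shows "weight_value N f (hamming_weight X) = f X"
  using assms unfolding weight_value_def symmetric_on_cube_def by (intro the_equality; blast)

lemma jump_exists:
  assumes "symmetric_on_cube N f" "nonconstant_on_cube N f"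
  shows "\<exists>k<N. weight_value N f k \<noteq> weight_value N f (Suc k)"
proof (rule ccontr)
  assume neg: "\<not> ?thesis"
  have const: "weight_value N f k = weight_value N f 0" if "k \<le> N" for k
    using that
  proof (induction k)
    case (Suc k)
    then have "k < N" by simp
    then show ?case using neg Suc by auto
  qed simp
  have "f X = weight_value N f 0" if X: "X \<in> cube N" for X
  proof -
    have "hamming_weight X \<le> N"
      using X count_le_length[of X True] by (simp add: cube_def hamming_weight_def)
    then show ?thesis using const[of "hamming_weight X"] weight_value_eq[OF assms(1) X] by blast
  qed
  then show False using assms(2) by (auto simp: nonconstant_on_cube_def)
qed

lemma Gamma_sym_attained:
  assumes "symmetric_on_cube N f" "nonconstant_on_cube N f"
  obtains k where "k < N" "weight_value N f k \<noteq> weight_value N f (Suc k)"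
    "Gamma_sym N f = \<bar>2 * int k - int N + 1\<bar>"
    "\<And>j. j < N \<Longrightarrow> weight_value N f j \<noteq> weight_value N f (Suc j) \<Longrightarrow>
      Gamma_sym N f \<le> \<bar>2 * int j - int N + 1\<bar>"
proof -
  let ?J = "{\<bar>2 * int k - int N + 1\<bar> | k. k < N \<and> weight_value N f k \<noteq> weight_value N f (Suc k)}"
  have fin: "finite ?J"
    by (rule finite_subset[of _ "(\<lambda>k. \<bar>2 * int k - int N + 1\<bar>) ` {..<N}"]) auto
  have "?J \<noteq> {}" using jump_exists[OF assms] by auto
  then have "Gamma_sym N f \<in> ?J" unfolding Gamma_sym_def by (rule Min_in[OF fin])
  moreover have "Gamma_sym N f \<le> j" if "j \<in> ?J" for j
    unfolding Gamma_sym_def using fin that by (rule Min_le)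
  ultimately show ?thesis using that by blast
qed

lemma network_of_symmetric:
  assumes N: "N \<ge> 1" and s: "symmetric_on_cube N f" and nc: "nonconstant_on_cube N f"
  shows "\<exists>K m U. quantum_network N m K U \<and> computes_bounded_error N f m K U \<and>
    real K \<le> 205 * sqrt (real N * (real N - real_of_int (Gamma_sym N f)))"
proof -
  obtain k where k: "k < N" "Gamma_sym N f = \<bar>2 * int k - int N + 1\<bar>"
    "\<And>j. j < N \<Longrightarrow> weight_value N f j \<noteq> weight_value N f (Suc j) \<Longrightarrow>
      Gamma_sym N f \<le> \<bar>2 * int j - int N + 1\<bar>"
    using Gamma_sym_attained[OF s nc] by metis
  define D where "D = nat (int N - Gamma_sym N f)"
  have D: "D \<ge> 1" "real D = real N - real_of_int (Gamma_sym N f)" "int D = int N - Gamma_sym N f"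
    using k(1,2) by (auto simp: D_def)
  \<comment> \<open>Half of \<open>N - \<Gamma>\<close>, rounded up. A jump at \<open>j\<close> with
    \<open>t \<le> j\<close> and \<open>j + 1 \<le> N - t\<close> would have
    \<open>|2j - N + 1| \<le> N - 2t - 1 < \<Gamma>\<close>, so the values are constant from
    \<open>t\<close> to \<open>N - t\<close>.\<close>
  define t where "t = (D + 1) div 2"
  have t: "t \<ge> 1" "t \<le> D" using D(1) by (auto simp: t_def)
  have no_jump: "weight_value N f j = weight_value N f (Suc j)" if "t \<le> j" "Suc j + t \<le> N" for j
  proof (rule ccontr)
    assume "weight_value N f j \<noteq> weight_value N f (Suc j)"
    then have "Gamma_sym N f \<le> \<bar>2 * int j - int N + 1\<bar>" using k(3)[of j] that by simp
    moreover have "D \<le> 2 * t" by (simp add: t_def)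
    ultimately show False using that D(3) by linarith
  qed
  have "weight_value N f j = weight_value N f t" if "t \<le> j" "j + t \<le> N" for j
    using that
  proof (induction j rule: dec_induct)
    case (step j)
    then show ?case using no_jump[of j] by simp
  qed simp
  then have mid: "weight_value N f j = weight_value N f l"
    if "t \<le> j" "j + t \<le> N" "t \<le> l" "l + t \<le> N" for j l using that by metis
  obtain v :: "bool list \<Rightarrow> nat \<Rightarrow> nat \<Rightarrow> real" and Z where v:
    "\<And>x y. x \<in> cube N \<Longrightarrow> y \<in> cube N \<Longrightarrow>
      2 * (\<Sum>i | i < N \<and> x ! i \<noteq> y ! i. \<Sum>z<Z. v x i z * v y i z) = of_bool (f x \<noteq> f y)"
    "\<And>x. x \<in> cube N \<Longrightarrow> (\<Sum>i<N. \<Sum>z<Z. (v x i z)\<^sup>2) \<le> 17 * sqrt (real N * real t)"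
    using symmetric_dual_solution[of N f "weight_value N f" t, OF weight_value_eq[OF s, symmetric] mid t(1) N]
    by blast
  \<comment> \<open>The factor is \<open>12 * 17 = 204\<close>; rounding up costs at most 1,
    absorbed into 205 because the root is at least 1.\<close>
  define K where "K = nat \<lceil>12 * (17 * sqrt (real N * real t))\<rceil>"
  have "1 * 1 \<le> real N * real t" using N t(1) by (intro mult_mono) auto
  then have "1 \<le> sqrt (real N * real t)" by simp
  then have K: "K \<ge> 1" "12 * (17 * sqrt (real N * real t)) \<le> real K"
    "real K \<le> 12 * (17 * sqrt (real N * real t)) + 1"
    unfolding K_def by linarith+
  have "sqrt (real N * real t) \<le> sqrt (real N * real D)"
    using t(2) by (intro real_sqrt_le_mono mult_left_mono) auto
  then have "real K \<le> 205 * sqrt (real N * real D)"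
    using K(3) \<open>1 \<le> sqrt (real N * real t)\<close> by linarith
  moreover obtain m U where "quantum_network N m K U" "computes_bounded_error N f m K U"
    using network_of_dual_solution[OF N K(1) v K(2)] by blast
  ultimately show ?thesis unfolding D(2) by blast
qed

theorem theorem4p10:
  shows "\<exists>c1 c2 :: real. c1 > 0 \<and> c2 > 0 \<and>
    (\<forall>(N :: nat) (f :: bool list \<Rightarrow> bool).
       N \<ge> 1 \<longrightarrow> symmetric_on_cube N f \<longrightarrow> nonconstant_on_cube N f \<longrightarrow>
         c1 * sqrt (real N * (real N - real_of_int (Gamma_sym N f))) \<le> real (Q2 N f) \<and>
         real (Q2 N f) \<le> c2 * sqrt (real N * (real N - real_of_int (Gamma_sym N f))))"
proof (rule exI[of _ "1 / 72"], rule exI[of _ 205], intro conjI allI impI)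
  fix N :: nat and f :: "bool list \<Rightarrow> bool"
  assume N: "N \<ge> 1" and s: "symmetric_on_cube N f" and nc: "nonconstant_on_cube N f"
  let ?G = "real_of_int (Gamma_sym N f)"
  let ?computable = "\<lambda>T. \<exists>m U. quantum_network N m T U \<and> computes_bounded_error N f m T U"
  obtain K where K: "?computable K" "real K \<le> 205 * sqrt (real N * (real N - ?G))"
    using network_of_symmetric[OF N s nc] by blast
  have "Q2 N f \<le> K" unfolding Q2_def using K(1) by (rule Least_le)
  then show "real (Q2 N f) \<le> 205 * sqrt (real N * (real N - ?G))" using K(2) by linarith
  \<comment> \<open>The network from the upper bound also guarantees that the minimum defining
    \<open>Q2\<close> is attained.\<close>
  have "?computable (Q2 N f)" unfolding Q2_def using K(1) by (rule LeastI)
  then obtain m U where Q: "quantum_network N m (Q2 N f) U" "computes_bounded_error N f m (Q2 N f) U"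
    by blast
  obtain k where k: "k < N" "weight_value N f k \<noteq> weight_value N f (Suc k)"
    "Gamma_sym N f = \<bar>2 * int k - int N + 1\<bar>"
    using Gamma_sym_attained[OF s nc] by metis
  have "f X \<noteq> f Y" if "X \<in> slice N k" "Y \<in> slice N (Suc k)" for X Y
    using that k(2) weight_value_eq[OF s, of X] weight_value_eq[OF s, of Y] by (auto simp: slice_def)
  then have adv: "sqrt (real (N - k) * real (k + 1)) \<le> 36 * real (Q2 N f)"
    by (rule adversary_bound[OF Q k(1)])
  \<comment> \<open>For \<open>k\<close> in the lower half \<open>N - \<Gamma> = 2k + 1\<close> and
    \<open>N \<le> 2 * (N - k)\<close>; in the upper half
    \<open>N - \<Gamma> = 2 * (N - k) - 1\<close> and \<open>N \<le> 2 * (k + 1)\<close>. The root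
    of the factor 4 turns 36 into 72.\<close>
  have "real N * (real N - ?G) \<le> 2\<^sup>2 * (real (N - k) * real (k + 1))"
  proof (cases "2 * k + 1 \<le> N")
    case True
    then have "real N - ?G \<le> 2 * real (k + 1)" "real N \<le> 2 * real (N - k)"
      using k by (auto simp: of_nat_diff)
    then have "real N * (real N - ?G) \<le> (2 * real (N - k)) * (2 * real (k + 1))"
      using True k by (intro mult_mono) auto
    then show ?thesis by (simp only: power2_eq_square mult_ac)
  next
    case False
    then have "real N - ?G \<le> 2 * real (N - k)" "real N \<le> 2 * real (k + 1)"
      using k by (auto simp: of_nat_diff)
    then have "real N * (real N - ?G) \<le> (2 * real (k + 1)) * (2 * real (N - k))"
      using False k by (intro mult_mono) auto
    then show ?thesis by (simp only: power2_eq_square mult_ac)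
  qed
  then have "sqrt (real N * (real N - ?G)) \<le> sqrt (2\<^sup>2 * (real (N - k) * real (k + 1)))"
    by (rule real_sqrt_le_mono)
  also have "\<dots> = 2 * sqrt (real (N - k) * real (k + 1))"
    by (simp add: real_sqrt_mult)
  finally have "sqrt (real N * (real N - ?G)) \<le> 2 * sqrt (real (N - k) * real (k + 1))" .
  then show "1 / 72 * sqrt (real N * (real N - ?G)) \<le> real (Q2 N f)" using adv by linarith
qed auto

end
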